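(* Let $\mathcal H$ be a Hilbert space of finite dimension $d$ and $\mathcal K$ a finite-dimensional Hilbert space. Let $\{M_j\}_{j=1}^d$ be positive operators on $\mathcal H$ with $M_j>0$ and $\sum_{j=1}^dM_j=I_{\mathcal H}$, let $\{|e_j\rangle\}_{j=1}^d$ be an orthonormal basis of $\mathcal H$, and let $\Phi$ be the quantum-classical channel $\Phi(\sigma)=\sum_{j=1}^d\mathrm{Tr}(M_j\sigma)|e_j\rangle\langle e_j|$. Then for every quantum channel $\Omega:\mathfrak S(\mathcal K)\to\mathfrak S(\mathcal K)$ and every $\rho\in\mathfrak S(\mathcal H\otimes\mathcal K)$, $$H_{\Phi\otimes\Omega}(\rho)\ge H_\Phi(\mathrm{Tr}_{\mathcal K}(\rho))+H_\Omega(\mathrm{Tr}_{\mathcal H}(\rho)).$$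
   Context: $\mathfrak S(\cdot)$ denotes the set of density operators; a quantum channel is a completely positive trace-preserving linear map; $S(\sigma)=-\mathrm{Tr}(\sigma\log\sigma)$ is the von Neumann entropy. For a channel $\Psi$ with input space $\mathcal L$ and $\sigma\in\mathfrak S(\mathcal L)$, $H_\Psi(\sigma):=\min\sum_{j}\pi_jS(\Psi(\sigma_j))$, the minimum over all finite decompositions $\sigma=\sum_j\pi_j\sigma_j$ with $\{\pi_j\}$ a probability distribution and $\sigma_j\in\mathfrak S(\mathcal L)$. *)

theory Defs
  imports "Jordan_Normal_Form.Matrix" "Jordan_Normal_Form.Char_Poly"
    "HOL-Computational_Algebra.Polynomial"
begin

text \<open>Operators on C^n are represented as complex n x n matrices. The composite
 space C^n1 (x) C^n2 is C^(n1*n2) with the basis index (i,k) encoded as i*n2+k.\<close>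

definition adj :: "complex mat \<Rightarrow> complex mat" where
  "adj A = mat (dim_col A) (dim_row A) (\<lambda>(i,j). cnj (A $$ (j,i)))"

definition qform :: "complex mat \<Rightarrow> complex vec \<Rightarrow> complex" where
  "qform A v = (\<Sum>i<dim_vec v. cnj (v $ i) * (A *\<^sub>v v) $ i)"

definition psd :: "nat \<Rightarrow> complex mat \<Rightarrow> bool" where
  "psd n A \<longleftrightarrow> A \<in> carrier_mat n n \<and> adj A = A \<and>
     (\<forall>v \<in> carrier_vec n. 0 \<le> Re (qform A v))"

definition pd :: "nat \<Rightarrow> complex mat \<Rightarrow> bool" where
  "pd n A \<longleftrightarrow> A \<in> carrier_mat n n \<and> adj A = A \<and>
     (\<forall>v \<in> carrier_vec n. v \<noteq> 0\<^sub>v n \<longrightarrow> 0 < Re (qform A v))"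

definition mtrace :: "complex mat \<Rightarrow> complex" where
  "mtrace A = (\<Sum>i<dim_row A. A $$ (i,i))"

definition density :: "nat \<Rightarrow> complex mat \<Rightarrow> bool" where
  "density n A \<longleftrightarrow> psd n A \<and> mtrace A = 1"

text \<open>Von Neumann entropy -Tr(A log A), computed through the eigenvalues of A
 (roots of the characteristic polynomial, counted with algebraic multiplicity);
 0 log 0 = 0.\<close>
definition vn_entropy :: "complex mat \<Rightarrow> real" where
  "vn_entropy A = - (\<Sum>x\<in>{x. poly (char_poly A) x = 0}.
      of_nat (order x (char_poly A)) * (if Re x = 0 then 0 else Re x * ln (Re x)))"

definition unit_mat :: "nat \<Rightarrow> nat \<Rightarrow> nat \<Rightarrow> complex mat" where
  "unit_mat n i j = mat n n (\<lambda>(p,q). if p = i \<and> q = j then 1 else 0)"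

text \<open>Tensor product of two maps (the first acting on n1 x n1, the second on
 n2 x n2 matrices, both dimension preserving), defined by linear extension on
 the product basis E_ij (x) F_kl.\<close>
definition tensor_map :: "nat \<Rightarrow> nat \<Rightarrow> (complex mat \<Rightarrow> complex mat) \<Rightarrow>
    (complex mat \<Rightarrow> complex mat) \<Rightarrow> complex mat \<Rightarrow> complex mat" where
  "tensor_map n1 n2 F G X = mat (n1*n2) (n1*n2) (\<lambda>(p,q).
     \<Sum>i<n1. \<Sum>j<n1. \<Sum>k<n2. \<Sum>l<n2.
       X $$ (i*n2+k, j*n2+l) * (F (unit_mat n1 i j)) $$ (p div n2, q div n2)
         * (G (unit_mat n2 k l)) $$ (p mod n2, q mod n2))"

definition linear_map :: "nat \<Rightarrow> (complex mat \<Rightarrow> complex mat) \<Rightarrow> bool" where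
  "linear_map n F \<longleftrightarrow>
     (\<forall>A \<in> carrier_mat n n. F A \<in> carrier_mat n n) \<and>
     (\<forall>A \<in> carrier_mat n n. \<forall>B \<in> carrier_mat n n. F (A + B) = F A + F B) \<and>
     (\<forall>A \<in> carrier_mat n n. \<forall>c. F (c \<cdot>\<^sub>m A) = c \<cdot>\<^sub>m F A)"

definition completely_positive :: "nat \<Rightarrow> (complex mat \<Rightarrow> complex mat) \<Rightarrow> bool" where
  "completely_positive n F \<longleftrightarrow>
     (\<forall>k X. psd (k*n) X \<longrightarrow> psd (k*n) (tensor_map k n (\<lambda>A. A) F X))"

definition trace_preserving :: "nat \<Rightarrow> (complex mat \<Rightarrow> complex mat) \<Rightarrow> bool" where
  "trace_preserving n F \<longleftrightarrow> (\<forall>A \<in> carrier_mat n n. mtrace (F A) = mtrace A)"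

definition channel :: "nat \<Rightarrow> (complex mat \<Rightarrow> complex mat) \<Rightarrow> bool" where
  "channel n F \<longleftrightarrow> linear_map n F \<and> completely_positive n F \<and> trace_preserving n F"

text \<open>H_Psi(sigma): minimum (infimum; it is attained) of the average output
 entropy over finite convex decompositions of sigma into states.\<close>
definition H_map :: "nat \<Rightarrow> (complex mat \<Rightarrow> complex mat) \<Rightarrow> complex mat \<Rightarrow> real" where
  "H_map n F \<sigma> = Inf {(\<Sum>j<N. p j * vn_entropy (F (s j))) | (N::nat) p s.
      (\<forall>j<N. 0 \<le> p j \<and> density n (s j)) \<and> (\<Sum>j<N. p j) = 1 \<and>
      (\<forall>a<n. \<forall>b<n. \<sigma> $$ (a,b) = (\<Sum>j<N. complex_of_real (p j) * s j $$ (a,b)))}"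

definition ptrace2 :: "nat \<Rightarrow> nat \<Rightarrow> complex mat \<Rightarrow> complex mat" where
  "ptrace2 n1 n2 X = mat n1 n1 (\<lambda>(i,j). \<Sum>k<n2. X $$ (i*n2+k, j*n2+k))"

definition ptrace1 :: "nat \<Rightarrow> nat \<Rightarrow> complex mat \<Rightarrow> complex mat" where
  "ptrace1 n1 n2 X = mat n2 n2 (\<lambda>(k,l). \<Sum>i<n1. X $$ (i*n2+k, i*n2+l))"

definition qc_channel :: "nat \<Rightarrow> (nat \<Rightarrow> complex mat) \<Rightarrow> (nat \<Rightarrow> complex vec) \<Rightarrow>
    complex mat \<Rightarrow> complex mat" where
  "qc_channel d M e \<sigma> = mat d d (\<lambda>(a,b).
     \<Sum>j<d. mtrace (M j * \<sigma>) * (e j $ a * cnj (e j $ b)))"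

definition cinner :: "complex vec \<Rightarrow> complex vec \<Rightarrow> complex" where
  "cinner u v = (\<Sum>i<dim_vec v. cnj (u $ i) * v $ i)"

end

theory Submission
  imports Defs "Jordan_Normal_Form.Schur_Decomposition"
begin

text \<open>For a single state \<open>\<sigma>\<close> on \<open>H \<otimes> K\<close> the output of \<open>\<Phi> \<otimes> \<Omega>\<close> is block diagonal,
  \<open>\<Sum>\<^sub>a |e\<^sub>a\<rangle>\<langle>e\<^sub>a| \<otimes> \<Omega>(T\<^sub>a)\<close> with \<open>T\<^sub>a = Tr\<^sub>H ((M\<^sub>a \<otimes> I) \<sigma>) = q\<^sub>a s\<^sub>a\<close>, where \<open>q\<^sub>a = Tr T\<^sub>a\<close> and
  \<open>s\<^sub>a\<close> is a state. Its entropy is therefore the Shannon entropy of \<open>q\<close> plus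
  \<open>\<Sum>\<^sub>a q\<^sub>a S(\<Omega>(s\<^sub>a))\<close>. The first summand equals \<open>S(\<Phi>(Tr\<^sub>K \<sigma>))\<close>, and \<open>\<Sum>\<^sub>a q\<^sub>a s\<^sub>a = Tr\<^sub>H \<sigma>\<close>
  because \<open>\<Sum>\<^sub>a M\<^sub>a = I\<close>. So a decomposition of \<open>\<rho>\<close> induces, with the same total cost,
  a decomposition of \<open>Tr\<^sub>K \<rho>\<close> and a (finer) one of \<open>Tr\<^sub>H \<rho>\<close>.\<close>

section \<open>Entropy in terms of the characteristic polynomial\<close>

definition xlnx :: "complex \<Rightarrow> real" where
  "xlnx x = (if Re x = 0 then 0 else Re x * ln (Re x))"

text \<open>The von Neumann entropy depends on a matrix only through its characteristic polynomial.
  Making the polynomial the argument turns additivity over diagonal blocks into a statement about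
  products of polynomials.\<close>

definition poly_entropy :: "complex poly \<Rightarrow> real" where
  "poly_entropy p = - (\<Sum>x\<in>{x. poly p x = 0}. of_nat (Polynomial.order x p) * xlnx x)"

lemma vn_entropy_char_poly: "vn_entropy A = poly_entropy (char_poly A)"
  by (simp add: vn_entropy_def poly_entropy_def xlnx_def)

text \<open>Points that are not roots have order 0, so sums for different polynomials can be taken
  over one common index set.\<close>

lemma poly_entropy_superset:
  assumes "p \<noteq> 0" "finite S" "{x. poly p x = 0} \<subseteq> S"
  shows "poly_entropy p = - (\<Sum>x\<in>S. of_nat (Polynomial.order x p) * xlnx x)"
  unfolding poly_entropy_def
  by (intro arg_cong[of _ _ uminus] sum.mono_neutral_left)
    (use assms in \<open>auto simp: order_root\<close>)

lemma poly_entropy_mult: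
  assumes "p \<noteq> 0" "q \<noteq> 0"
  shows "poly_entropy (p * q) = poly_entropy p + poly_entropy q"
proof -
  let ?S = "{x. poly (p * q) x = 0}"
  have fin: "finite ?S"
    by (rule poly_roots_finite) (use assms in simp)
  have "poly_entropy p + poly_entropy q
      = - (\<Sum>x\<in>?S. of_nat (Polynomial.order x p) * xlnx x) - (\<Sum>x\<in>?S. of_nat (Polynomial.order x q) * xlnx x)"
    using fin assms by (subst (1 2) poly_entropy_superset[where S = ?S]) auto
  also have "\<dots> = poly_entropy (p * q)"
    unfolding poly_entropy_def
    by (simp add: order_mult assms sum.distrib algebra_simps)
  finally show ?thesis by simp
qed

lemma poly_entropy_one [simp]: "poly_entropy 1 = 0"
  by (simp add: poly_entropy_def)

lemma poly_entropy_linear: "poly_entropy [:- a, 1:] = - xlnx a"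
proof -
  have "{x. poly [:- a, 1:] x = 0} = {a}" by auto
  moreover have "Polynomial.order a [:- a, 1:] = 1"
    using order_power_n_n[of a 1] by simp
  ultimately show ?thesis by (simp add: poly_entropy_def)
qed

lemma poly_entropy_prod_list:
  "poly_entropy (\<Prod>a\<leftarrow>as. [:- a, 1:]) = - (\<Sum>a\<leftarrow>as. xlnx a)"
proof (induction as)
  case (Cons a as)
  have "(\<Prod>a\<leftarrow>as. [:- a, 1:]) \<noteq> (0 :: complex poly)"
    by (auto simp: prod_list_zero_iff)
  with Cons show ?case
    by (simp add: poly_entropy_mult poly_entropy_linear del: mult_pCons_left)
qed simp

lemma poly_entropy_prod:
  assumes "finite I" "\<And>i. i \<in> I \<Longrightarrow> p i \<noteq> 0"
  shows "poly_entropy (\<Prod>i\<in>I. p i) = (\<Sum>i\<in>I. poly_entropy (p i))"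
  using assms by (induction I rule: finite_induct) (auto simp: poly_entropy_mult)

section \<open>Spectra of complex matrices and the entropy of scaled states\<close>

lemma char_poly_nonzero:
  assumes "(A :: complex mat) \<in> carrier_mat n n"
  shows "char_poly A \<noteq> 0"
  using degree_monic_char_poly[OF assms] by auto

lemma mtrace_mult_commute:
  assumes "A \<in> carrier_mat n m" "B \<in> carrier_mat m n"
  shows "mtrace (A * B) = mtrace (B * A)"
proof -
  have "mtrace (A * B) = (\<Sum>i<n. \<Sum>j<m. A $$ (i,j) * B $$ (j,i))"
    using assms by (simp add: mtrace_def scalar_prod_def lessThan_atLeast0)
  also have "\<dots> = (\<Sum>j<m. \<Sum>i<n. B $$ (j,i) * A $$ (i,j))"
    by (subst sum.swap) (simp add: mult.commute)
  also have "\<dots> = mtrace (B * A)"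
    using assms by (simp add: mtrace_def scalar_prod_def lessThan_atLeast0)
  finally show ?thesis .
qed

lemma upper_triangular_smult:
  assumes "upper_triangular B" "(B :: complex mat) \<in> carrier_mat n n"
  shows "upper_triangular (c \<cdot>\<^sub>m B)"
  using assms unfolding upper_triangular_def by auto

text \<open>Schur triangularisation: \<open>as\<close> is the diagonal of a triangular matrix
  \<open>B\<close> similar to \<open>A\<close>. Cyclicity of the trace gives the sum, and scaling
  \<open>B\<close> shows that the same list, multiplied by \<open>c\<close>, serves every multiple
  of \<open>A\<close>.\<close>

lemma complex_spectrum:
  assumes A: "(A :: complex mat) \<in> carrier_mat n n"
  obtains as where "char_poly A = (\<Prod>a\<leftarrow>as. [:- a, 1:])" "sum_list as = mtrace A"
    "\<forall>c. char_poly (c \<cdot>\<^sub>m A) = (\<Prod>a\<leftarrow>as. [:- (c * a), 1:])"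
proof -
  from char_poly_factorized[OF A] obtain as
    where as: "char_poly A = (\<Prod>a\<leftarrow>as. [:- a, 1:])" by blast
  obtain B P Q where BPQ: "schur_decomposition A as = (B, P, Q)"
    by (cases "schur_decomposition A as") auto
  from schur_decomposition[OF A as BPQ]
  have sim: "similar_mat_wit A B P Q" and ut: "upper_triangular B" and diag: "diag_mat B = as"
    by auto
  note wit = similar_mat_witD2[OF A sim]
  have "mtrace A = mtrace (P * (B * Q))"
    by (subst wit(3)) (simp add: assoc_mult_mat[OF wit(6,5,7)])
  also have "\<dots> = mtrace (B * Q * P)"
    using wit by (intro mtrace_mult_commute) auto
  also have "B * Q * P = B"
    by (simp add: assoc_mult_mat[OF wit(5,7,6)] wit(2) right_mult_one_mat[OF wit(5)])
  also have "mtrace B = sum_list as"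
    unfolding diag[symmetric] diag_mat_def mtrace_def
    by (simp add: interv_sum_list_conv_sum_set_nat lessThan_atLeast0)
  finally have tr: "sum_list as = mtrace A" by simp
  have "char_poly (c \<cdot>\<^sub>m A) = (\<Prod>a\<leftarrow>as. [:- (c * a), 1:])" for c
  proof -
    have "char_poly (c \<cdot>\<^sub>m A) = char_poly (c \<cdot>\<^sub>m B)"
      using sim by (intro char_poly_similar similar_mat_smult) (auto simp: similar_mat_def)
    also have "\<dots> = (\<Prod>a\<leftarrow>diag_mat (c \<cdot>\<^sub>m B). [:- a, 1:])"
      by (rule char_poly_upper_triangular[of _ n])
        (use wit ut in \<open>auto intro: upper_triangular_smult\<close>)
    also have "diag_mat (c \<cdot>\<^sub>m B) = map (\<lambda>a. c * a) as"
      unfolding diag[symmetric] diag_mat_def using wit by auto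
    finally show ?thesis by (simp add: o_def)
  qed
  with that[OF as tr] show thesis by blast
qed

lemma vn_entropy_spectrum:
  assumes "char_poly A = (\<Prod>a\<leftarrow>as. [:- a, 1:])"
  shows "vn_entropy A = - (\<Sum>a\<leftarrow>as. xlnx a)"
  by (simp add: vn_entropy_char_poly assms poly_entropy_prod_list)

lemma vn_entropy_zero_mat: "vn_entropy (0\<^sub>m n n) = 0"
proof -
  have "char_poly (0\<^sub>m n n :: complex mat) = (\<Prod>a\<leftarrow>diag_mat (0\<^sub>m n n). [:- a, 1:])"
    by (rule char_poly_upper_triangular[of _ n]) (auto simp: upper_triangular_def)
  then have "vn_entropy (0\<^sub>m n n) = - (\<Sum>a\<leftarrow>diag_mat (0\<^sub>m n n). xlnx a)"
    by (rule vn_entropy_spectrum)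
  also have "(\<Sum>a\<leftarrow>diag_mat (0\<^sub>m n n :: complex mat). xlnx a) = 0"
    by (auto simp: diag_mat_def xlnx_def o_def interv_sum_list_conv_sum_set_nat)
  finally show ?thesis by simp
qed

text \<open>At an eigenvector \<open>v\<close> for \<open>k\<close> the quadratic form equals
  \<open>k\<close> times the squared norm of \<open>v\<close>, which is positive.\<close>

lemma psd_spectrum_nonneg:
  assumes A: "psd n A" and k: "poly (char_poly A) k = 0"
  shows "0 \<le> Re k"
proof -
  have carr: "A \<in> carrier_mat n n" using A by (simp add: psd_def)
  from k obtain v where v: "v \<in> carrier_vec n" "v \<noteq> 0\<^sub>v n" "A *\<^sub>v v = k \<cdot>\<^sub>v v"
    using eigenvalue_root_char_poly[OF carr] carr unfolding eigenvalue_def eigenvector_def by auto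
  let ?N = "\<Sum>i<n. (cmod (v $ i))\<^sup>2"
  have "qform A v = (\<Sum>i<n. k * (v $ i * cnj (v $ i)))"
    unfolding qform_def v(3) using v(1) by (intro sum.cong) auto
  also have "\<dots> = (\<Sum>i<n. k * complex_of_real ((cmod (v $ i))\<^sup>2))"
    by (simp only: complex_norm_square)
  also have "\<dots> = k * complex_of_real ?N"
    by (simp add: sum_distrib_left)
  finally have "Re (qform A v) = Re k * ?N" by simp
  moreover have "0 \<le> Re (qform A v)" using A v(1) by (auto simp: psd_def)
  moreover have "?N > 0"
  proof -
    obtain i where "i < n" "v $ i \<noteq> 0"
      using v(1,2) by (metis carrier_vecD eq_vecI index_zero_vec)
    then show ?thesis by (intro sum_pos2[of _ i]) auto
  qed
  ultimately show ?thesis by (auto simp: zero_le_mult_iff)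
qed

lemma density_spectrum:
  assumes A: "density n A"
  obtains as where "char_poly A = (\<Prod>a\<leftarrow>as. [:- a, 1:])"
    "\<forall>a\<in>set as. 0 \<le> Re a" "(\<Sum>a\<leftarrow>as. Re a) = 1"
    "\<forall>c. char_poly (c \<cdot>\<^sub>m A) = (\<Prod>a\<leftarrow>as. [:- (c * a), 1:])"
proof -
  have carr: "A \<in> carrier_mat n n" using A by (auto simp: density_def psd_def)
  obtain as where as: "char_poly A = (\<Prod>a\<leftarrow>as. [:- a, 1:])" "sum_list as = mtrace A"
    "\<forall>c. char_poly (c \<cdot>\<^sub>m A) = (\<Prod>a\<leftarrow>as. [:- (c * a), 1:])"
    using complex_spectrum[OF carr] by metis
  have "(\<Sum>a\<leftarrow>as. Re a) = Re (sum_list as)" by (induction as) auto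
  then have "(\<Sum>a\<leftarrow>as. Re a) = 1" using as(2) A by (simp add: density_def)
  moreover have "0 \<le> Re a" if "a \<in> set as" for a
  proof (rule psd_spectrum_nonneg)
    show "psd n A" using A by (simp add: density_def)
    show "poly (char_poly A) a = 0"
      unfolding as(1) poly_prod_list using that by (auto simp: prod_list_zero_iff image_iff)
  qed
  ultimately show thesis using that[OF as(1) _ _ as(3)] by simp
qed

text \<open>The eigenvalues are nonnegative and sum to 1, so each is at most 1 and x ln x is
  nonpositive there. This keeps the sets of costs behind \<open>H_map\<close> bounded below.\<close>

lemma vn_entropy_density_nonneg:
  assumes "density n A"
  shows "0 \<le> vn_entropy A"
proof -
  obtain as where as: "char_poly A = (\<Prod>a\<leftarrow>as. [:- a, 1:])"
    "\<forall>a\<in>set as. 0 \<le> Re a" "(\<Sum>a\<leftarrow>as. Re a) = 1"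
    "\<forall>c. char_poly (c \<cdot>\<^sub>m A) = (\<Prod>a\<leftarrow>as. [:- (c * a), 1:])"
    using density_spectrum[OF assms] by metis
  have "xlnx a \<le> 0" if a: "a \<in> set as" for a
  proof -
    have "Re a \<le> (\<Sum>a\<leftarrow>as. Re a)"
      by (rule member_le_sum_list) (use as(2) a in auto)
    with as(2) a as(3) show ?thesis
      by (auto simp: xlnx_def mult_nonneg_nonpos)
  qed
  then have "(\<Sum>a\<leftarrow>as. xlnx a) \<le> 0"
    by (intro sum_list_nonpos) auto
  then show ?thesis by (simp add: vn_entropy_spectrum[OF as(1)])
qed

text \<open>From qa ln(qa) = q (a ln a) + (q ln q) a, summed over eigenvalues \<open>a\<close> of
  total 1. The terms \<open>- xlnx q\<close> of the conditional states later add up to a Shannon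
  entropy.\<close>

lemma vn_entropy_smult_density:
  assumes "density n A" "q \<ge> 0"
  shows "vn_entropy (complex_of_real q \<cdot>\<^sub>m A) = q * vn_entropy A - xlnx (complex_of_real q)"
proof (cases "q = 0")
  case True
  have "A \<in> carrier_mat n n" using assms by (simp add: density_def psd_def)
  then have "complex_of_real q \<cdot>\<^sub>m A = 0\<^sub>m n n" using True by auto
  then show ?thesis using True by (simp add: vn_entropy_zero_mat xlnx_def)
next
  case False
  then have q: "q > 0" using assms by simp
  obtain as where as: "char_poly A = (\<Prod>a\<leftarrow>as. [:- a, 1:])"
    "\<forall>a\<in>set as. 0 \<le> Re a" "(\<Sum>a\<leftarrow>as. Re a) = 1"
    "\<forall>c. char_poly (c \<cdot>\<^sub>m A) = (\<Prod>a\<leftarrow>as. [:- (c * a), 1:])"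
    using density_spectrum[OF assms(1)] by metis
  have *: "xlnx (complex_of_real q * a) = q * xlnx a + q * ln q * Re a" if "a \<in> set as" for a
  \<comment> \<open>The logarithm of the product splits only for positive factors; at a zero
    eigenvalue both sides vanish by the convention 0 ln 0 = 0.\<close>
  proof (cases "Re a = 0")
    case False
    with as(2) that have "Re a > 0" by force
    with q show ?thesis by (simp add: xlnx_def ln_mult algebra_simps)
  qed (simp add: xlnx_def)
  have "char_poly (complex_of_real q \<cdot>\<^sub>m A)
      = (\<Prod>a\<leftarrow>map (\<lambda>a. complex_of_real q * a) as. [:- a, 1:])"
    using as(4) by (simp add: o_def)
  from vn_entropy_spectrum[OF this]
  have "vn_entropy (complex_of_real q \<cdot>\<^sub>m A) = - (\<Sum>a\<leftarrow>as. xlnx (complex_of_real q * a))"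
    by (simp add: o_def)
  also have "(\<Sum>a\<leftarrow>as. xlnx (complex_of_real q * a)) = (\<Sum>a\<leftarrow>as. q * xlnx a + q * ln q * Re a)"
    using * by (intro arg_cong[of _ _ sum_list] map_cong) auto
  also have "\<dots> = q * (\<Sum>a\<leftarrow>as. xlnx a) + q * ln q * (\<Sum>a\<leftarrow>as. Re a)"
    by (simp add: sum_list_addf sum_list_const_mult)
  finally show ?thesis using q by (simp add: vn_entropy_spectrum[OF as(1)] as(3) xlnx_def)
qed

lemma vn_entropy_one_by_one:
  "vn_entropy (mat 1 1 (\<lambda>_. c)) = - xlnx c"
proof -
  let ?A = "mat 1 1 (\<lambda>_. c)"
  have "char_poly ?A = (\<Prod>a\<leftarrow>diag_mat ?A. [:- a, 1:])"
    by (rule char_poly_upper_triangular[of _ 1]) (auto simp: upper_triangular_def)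
  from vn_entropy_spectrum[OF this] show ?thesis by (simp add: diag_mat_def)
qed

section \<open>Positive semidefinite matrices\<close>

text \<open>The form of a matrix on coefficient functions instead of \<open>mat\<close> and
  \<open>vec\<close>: single coordinates can be changed by function update and entries modified by a
  lambda term, without carrier conditions.\<close>

definition sesq :: "nat \<Rightarrow> (nat \<Rightarrow> nat \<Rightarrow> complex) \<Rightarrow> (nat \<Rightarrow> complex) \<Rightarrow> complex" where
  "sesq n a u = (\<Sum>i<n. cnj (u i) * (\<Sum>j<n. a i j * u j))"

definition herm_psd :: "nat \<Rightarrow> (nat \<Rightarrow> nat \<Rightarrow> complex) \<Rightarrow> bool" where
  "herm_psd n a \<longleftrightarrow> (\<forall>i<n. \<forall>j<n. cnj (a j i) = a i j) \<and> (\<forall>u. 0 \<le> Re (sesq n a u))"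

lemma qform_eq_sesq:
  assumes "A \<in> carrier_mat n n"
  shows "qform A (vec n u) = sesq n (\<lambda>i j. A $$ (i,j)) u"
  using assms by (auto simp: qform_def sesq_def scalar_prod_def lessThan_atLeast0 intro!: sum.cong)

lemma psd_iff_herm_psd:
  "psd n A \<longleftrightarrow> A \<in> carrier_mat n n \<and> herm_psd n (\<lambda>i j. A $$ (i,j))"
proof (cases "A \<in> carrier_mat n n")
  case True
  have "adj A = A \<longleftrightarrow> (\<forall>i<n. \<forall>j<n. cnj (A $$ (j,i)) = A $$ (i,j))"
    using True by (auto simp: adj_def mat_eq_iff)
  moreover have "(\<forall>v\<in>carrier_vec n. 0 \<le> Re (qform A v)) \<longleftrightarrow>
      (\<forall>u. 0 \<le> Re (sesq n (\<lambda>i j. A $$ (i,j)) u))"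
  proof
    assume "\<forall>v\<in>carrier_vec n. 0 \<le> Re (qform A v)"
    then show "\<forall>u. 0 \<le> Re (sesq n (\<lambda>i j. A $$ (i,j)) u)"
      using qform_eq_sesq[OF True] vec_carrier by metis
  next
    assume *: "\<forall>u. 0 \<le> Re (sesq n (\<lambda>i j. A $$ (i,j)) u)"
    show "\<forall>v\<in>carrier_vec n. 0 \<le> Re (qform A v)"
    proof
      fix v :: "complex vec" assume "v \<in> carrier_vec n"
      then have "v = vec n (\<lambda>i. v $ i)" by auto
      then show "0 \<le> Re (qform A v)"
        using * qform_eq_sesq[OF True] by metis
    qed
  qed
  ultimately show ?thesis using True by (simp add: psd_def herm_psd_def)
qed (simp add: psd_def)

section \<open>Schur complements and rank-one sums\<close>

lemma sesq_fun_upd: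
  assumes "k < n"
  shows "sesq n a (u(k := u k + t)) = sesq n a u + cnj t * (\<Sum>j<n. a k j * u j)
    + t * (\<Sum>i<n. cnj (u i) * a i k) + cnj t * t * a k k"
proof -
  let ?R = "\<lambda>i. (\<Sum>j<n. a i j * u j) + t * a i k"
  have inner: "(\<Sum>j<n. a i j * (u(k := u k + t)) j) = ?R i" for i
  proof -
    have "(\<Sum>j<n. a i j * (u(k := u k + t)) j)
        = (\<Sum>j<n. a i j * u j + (if j = k then t * a i k else 0))"
      by (rule sum.cong) (auto simp: algebra_simps)
    then show ?thesis using assms by (simp add: sum.distrib)
  qed
  have "sesq n a (u(k := u k + t)) = (\<Sum>i<n. cnj ((u(k := u k + t)) i) * ?R i)"
    unfolding sesq_def inner ..
  also have "\<dots> = (\<Sum>i<n. cnj (u i) * ?R i + (if i = k then cnj t * ?R k else 0))"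
    by (rule sum.cong) (auto simp: algebra_simps)
  also have "\<dots> = (\<Sum>i<n. cnj (u i) * ?R i) + cnj t * ?R k"
    using assms by (simp add: sum.distrib)
  also have "(\<Sum>i<n. cnj (u i) * ?R i) = sesq n a u + t * (\<Sum>i<n. cnj (u i) * a i k)"
    by (simp add: sesq_def sum.distrib sum_distrib_left algebra_simps)
  finally show ?thesis by (simp add: algebra_simps fun_upd_def)
qed

text \<open>Positivity at u + t e_k; hermiticity merges the two cross terms into one real part. This
  quadratic in \<open>t\<close> is used twice: to see that a zero pivot kills its row, and to
  complete the square.\<close>

lemma herm_psd_shift:
  assumes "herm_psd n a" "k < n"
  defines "z \<equiv> \<lambda>u. \<Sum>j<n. a k j * u j"
  shows "0 \<le> Re (sesq n a u) + 2 * Re (cnj t * z u) + (cmod t)\<^sup>2 * Re (a k k)"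
proof -
  have "(\<Sum>i<n. cnj (u i) * a i k) = cnj (z u)"
    using assms(1,2) unfolding z_def cnj_sum
    by (intro sum.cong) (auto simp: herm_psd_def mult.commute)
  then have "sesq n a (u(k := u k + t)) = sesq n a u + cnj t * z u + t * cnj (z u) + cnj t * t * a k k"
    using sesq_fun_upd[OF assms(2), of a u t] by (simp add: z_def)
  moreover have "cnj t * t = complex_of_real ((cmod t)\<^sup>2)"
    by (simp only: complex_norm_square mult.commute)
  ultimately have "Re (sesq n a (u(k := u k + t)))
      = Re (sesq n a u) + 2 * Re (cnj t * z u) + (cmod t)\<^sup>2 * Re (a k k)"
    by simp
  then show ?thesis using assms(1) by (metis herm_psd_def)
qed

lemma sesq_unit:
  assumes "i < n"
  shows "sesq n a (\<lambda>j. if j = i then 1 else 0) = a i i"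
proof -
  have "sesq n a (\<lambda>j. if j = i then 1 else 0)
      = (\<Sum>k<n. if k = i then a i i else 0)"
    unfolding sesq_def using assms by (intro sum.cong) (auto simp: if_distrib cong: if_cong)
  then show ?thesis using assms by simp
qed

lemma herm_psd_diag_nonneg:
  assumes "herm_psd n a" "i < n"
  shows "0 \<le> Re (a i i)" "a i i = complex_of_real (Re (a i i))"
proof -
  show "0 \<le> Re (a i i)" using assms sesq_unit[OF assms(2), of a] by (metis herm_psd_def)
  have "cnj (a i i) = a i i" using assms by (auto simp: herm_psd_def)
  then show "a i i = complex_of_real (Re (a i i))"
    by (simp add: complex_eq_iff)
qed

lemma herm_psd_zero_diag:
  assumes psd: "herm_psd n a" and k: "k < n" and i: "i < n" and zero: "a k k = 0"
  shows "a k i = 0" "a i k = 0"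
proof -
  let ?z = "a k i"
  show z: "?z = 0"
  proof (rule ccontr)
    assume nz: "?z \<noteq> 0"
    \<comment> \<open>With u = e_i and t = -s \<open>?z\<close> the quadratic term vanishes because
      \<open>a k k = 0\<close>. This \<open>s\<close> makes the value equal to -Re(a i i) - 2, which
      is negative.\<close>
    define s where "s = (Re (a i i) + 1) / (cmod ?z)\<^sup>2"
    have sum: "(\<Sum>j<n. a k j * (if j = i then 1 else 0)) = ?z"
      using i by (simp add: if_distrib cong: if_cong)
    have "0 \<le> Re (a i i) + 2 * Re (cnj (- (complex_of_real s * ?z)) * ?z)"
      using herm_psd_shift[OF psd k, of "\<lambda>j. if j = i then 1 else 0" "- (complex_of_real s * ?z)"]
      unfolding sum sesq_unit[OF i] zero by simp
    also have "cnj (- (complex_of_real s * ?z)) * ?z = - complex_of_real (s * (cmod ?z)\<^sup>2)"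
      by (simp only: complex_norm_square of_real_mult) simp
    also have "s * (cmod ?z)\<^sup>2 = Re (a i i) + 1"
      using nz by (simp add: s_def)
    finally show False using herm_psd_diag_nonneg(1)[OF psd i] by simp
  qed
  then show "a i k = 0" using psd i k by (metis complex_cnj_zero herm_psd_def)
qed

text \<open>Completing the square: the form of \<open>b\<close> at \<open>u\<close> is the value of
  the form of \<open>a\<close> at u + t e_k for the minimising t = -z/c, where \<open>c\<close> is
  the pivot and \<open>z\<close> is entry \<open>k\<close> of \<open>a\<close> applied to
  \<open>u\<close>.\<close>

lemma herm_psd_schur_complement:
  assumes psd: "herm_psd n a" and k: "k < n"
  defines "b \<equiv> \<lambda>i j. a i j - a i k * cnj (a j k) / a k k"
  shows "herm_psd n b"
proof (cases "a k k = 0")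
  \<comment> \<open>Division by 0 yields 0, so \<open>b\<close> coincides with
    \<open>a\<close>.\<close>
  case True
  then show ?thesis using psd by (simp add: b_def)
next
  case False
  obtain c where c: "a k k = complex_of_real c" "c > 0"
    using herm_psd_diag_nonneg[OF psd k] False by (metis less_eq_real_def of_real_0)
  have herm: "cnj (a j i) = a i j" if "i < n" "j < n" for i j
    using psd that by (auto simp: herm_psd_def)
  have "cnj (b j i) = b i j" if "i < n" "j < n" for i j
    using herm[OF that] by (simp add: b_def c mult.commute)
  moreover have "0 \<le> Re (sesq n b u)" for u
  proof -
    define z where "z = (\<Sum>j<n. a k j * u j)"
    have z1: "(\<Sum>j<n. cnj (a j k) * u j) = z"
      unfolding z_def by (intro sum.cong) (auto simp: herm k)
    have z2: "(\<Sum>i<n. cnj (u i) * a i k) = cnj z"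
      unfolding z1[symmetric] by (simp add: mult.commute)
    have "sesq n b u = (\<Sum>i<n. cnj (u i) * (\<Sum>j<n. a i j * u j)
        - cnj (u i) * a i k * (\<Sum>j<n. cnj (a j k) * u j) / c)"
      unfolding sesq_def b_def c(1)
      by (simp add: algebra_simps sum_subtractf sum_distrib_left sum_divide_distrib)
    also have "\<dots> = sesq n a u - (\<Sum>i<n. cnj (u i) * a i k) * z / c"
      unfolding z1 by (simp add: sesq_def sum_subtractf sum_distrib_right sum_divide_distrib)
    also have "\<dots> = sesq n a u - complex_of_real ((cmod z)\<^sup>2 / c)"
      unfolding z2 of_real_divide complex_norm_square by (simp add: mult.commute)
    finally have b: "Re (sesq n b u) = Re (sesq n a u) - (cmod z)\<^sup>2 / c" by simp
    have cross: "cnj (- (z / complex_of_real c)) * z = - complex_of_real ((cmod z)\<^sup>2 / c)"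
      unfolding of_real_divide complex_norm_square by simp
    have square: "(cmod (- (z / complex_of_real c)))\<^sup>2 * c = (cmod z)\<^sup>2 / c"
      using c(2) by (simp add: norm_divide power_divide power2_eq_square)
    have "0 \<le> Re (sesq n a u) - (cmod z)\<^sup>2 / c"
      using herm_psd_shift[OF psd k, of u "- (z / complex_of_real c)"]
      unfolding z_def[symmetric] c(1) Re_complex_of_real cross square by simp
    then show ?thesis using b by simp
  qed
  ultimately show ?thesis by (simp add: herm_psd_def)
qed

text \<open>Outer-product Cholesky decomposition: the pivots are eliminated from the last index down.\<close>
lemma herm_psd_rank_one_sum_aux:
  assumes "herm_psd n a" "k \<le> n" "\<And>i j. i < n \<Longrightarrow> j < n \<Longrightarrow> k \<le> i \<or> k \<le> j \<Longrightarrow> a i j = 0"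
  shows "\<exists>w. \<forall>i<n. \<forall>j<n. a i j = (\<Sum>r<k. w r i * cnj (w r j))"
  using assms
proof (induction k arbitrary: a)
  case 0
  then show ?case by simp
next
  case (Suc k)
  note psd = Suc.prems(1)
  have k: "k < n" using Suc.prems by simp
  \<comment> \<open>Eliminating pivot \<open>k\<close> clears row and column \<open>k\<close>, while
    the rows and columns beyond it stay zero; hence the induction hypothesis applies to
    \<open>b\<close>.\<close>
  define b where "b = (\<lambda>i j. a i j - a i k * cnj (a j k) / a k k)"
  have herm: "cnj (a j i) = a i j" if "i < n" "j < n" for i j
    using psd that by (auto simp: herm_psd_def)
  have "herm_psd n b" unfolding b_def using psd k by (rule herm_psd_schur_complement)
  moreover have "b i j = 0" if "i < n" "j < n" "k \<le> i \<or> k \<le> j" for i j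
  proof (cases "i = k \<or> j = k")
    case True
    show ?thesis
    proof (cases "a k k = 0")
      case True
      with \<open>i = k \<or> j = k\<close> show ?thesis
        using herm_psd_zero_diag[OF psd k] that by (auto simp: b_def)
    next
      case False
      with \<open>i = k \<or> j = k\<close> that k show ?thesis
        by (auto simp: b_def herm)
    qed
  next
    case False
    with that have "Suc k \<le> i \<or> Suc k \<le> j" by auto
    then have "a i j = 0" "a i k * cnj (a j k) = 0"
      using Suc.prems(3) that k by auto
    then show ?thesis by (simp add: b_def)
  qed
  ultimately obtain w where w: "\<forall>i<n. \<forall>j<n. b i j = (\<Sum>r<k. w r i * cnj (w r j))"
    using Suc.IH[of b] k by auto
  obtain c where c: "a k k = complex_of_real c" "c \<ge> 0"
    using herm_psd_diag_nonneg[OF psd k] by metis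
  have sq: "complex_of_real (sqrt c) * complex_of_real (sqrt c) = complex_of_real c"
    using c(2) by (simp flip: of_real_mult)
  \<comment> \<open>The new vector is column \<open>k\<close> divided by the square root of the
    pivot. For a zero pivot the division gives the zero vector, matching the vanishing correction in
    \<open>b\<close>.\<close>
  define w' where "w' = w(k := \<lambda>i. a i k / complex_of_real (sqrt c))"
  have "a i j = (\<Sum>r<Suc k. w' r i * cnj (w' r j))" if "i < n" "j < n" for i j
  proof -
    have "(\<Sum>r<Suc k. w' r i * cnj (w' r j)) = b i j + w' k i * cnj (w' k j)"
      using w that by (simp add: w'_def)
    also have "w' k i * cnj (w' k j) = a i k * cnj (a j k) / a k k"
      by (simp add: w'_def c(1) sq)
    finally show ?thesis by (simp add: b_def)
  qed
  then show ?case by blast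
qed

lemma psd_rank_one_sum:
  assumes "psd n A"
  obtains w where "\<forall>i<n. \<forall>j<n. A $$ (i,j) = (\<Sum>r<n. w r i * cnj (w r j))"
  using herm_psd_rank_one_sum_aux[of n "\<lambda>i j. A $$ (i,j)" n] assms
  by (auto simp: psd_iff_herm_psd)

text \<open>A nonnegative diagonal with sum 0 vanishes, and zero diagonal entries force zero rows.
  It handles measurement outcomes of probability 0.\<close>

lemma psd_zero_trace:
  assumes "psd n A" "mtrace A = 0"
  shows "A = 0\<^sub>m n n"
proof -
  have carr: "A \<in> carrier_mat n n" and psd: "herm_psd n (\<lambda>i j. A $$ (i,j))"
    using assms(1) by (auto simp: psd_iff_herm_psd)
  have "(\<Sum>i<n. Re (A $$ (i,i))) = 0"
    using assms(2) carr by (metis Re_sum carrier_matD(1) mtrace_def zero_complex.simps(1))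
  then have "Re (A $$ (i,i)) = 0" if "i < n" for i
    using that herm_psd_diag_nonneg(1)[OF psd] by (subst (asm) sum_nonneg_eq_0_iff) auto
  then have "A $$ (i,i) = 0" if "i < n" for i
    using that herm_psd_diag_nonneg(2)[OF psd that] by simp
  then have "A $$ (i,j) = 0" if "i < n" "j < n" for i j
    using that herm_psd_zero_diag(1)[OF psd] by simp
  then show ?thesis using carr by (intro eq_matI) auto
qed

lemma mtrace_psd:
  assumes "psd n A"
  shows "mtrace A = complex_of_real (Re (mtrace A))" "0 \<le> Re (mtrace A)"
proof -
  have carr: "A \<in> carrier_mat n n" and psd: "herm_psd n (\<lambda>i j. A $$ (i,j))"
    using assms by (auto simp: psd_iff_herm_psd)
  have "mtrace A = (\<Sum>i<n. complex_of_real (Re (A $$ (i,i))))"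
    unfolding mtrace_def using carr herm_psd_diag_nonneg(2)[OF psd] by (intro sum.cong) auto
  then have *: "mtrace A = complex_of_real (\<Sum>i<n. Re (A $$ (i,i)))" by simp
  then show "mtrace A = complex_of_real (Re (mtrace A))" by simp
  show "0 \<le> Re (mtrace A)"
    unfolding * using herm_psd_diag_nonneg(1)[OF psd] by (auto intro!: sum_nonneg)
qed

lemma psd_smult:
  assumes "psd n A" "0 \<le> c"
  shows "psd n (complex_of_real c \<cdot>\<^sub>m A)"
proof -
  have A: "A \<in> carrier_mat n n" "herm_psd n (\<lambda>i j. A $$ (i,j))"
    using assms(1) by (auto simp: psd_iff_herm_psd)
  have "sesq n (\<lambda>i j. (complex_of_real c \<cdot>\<^sub>m A) $$ (i,j)) u
      = complex_of_real c * sesq n (\<lambda>i j. A $$ (i,j)) u" for u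
    using A(1) by (simp add: sesq_def sum_distrib_left mult_ac)
  with A assms(2) show ?thesis by (auto simp: psd_iff_herm_psd herm_psd_def)
qed

lemma sum_swap_pairs:
  "(\<Sum>k\<in>A. \<Sum>l\<in>B. \<Sum>p\<in>C. \<Sum>q\<in>D. f k l p q) = (\<Sum>p\<in>C. \<Sum>q\<in>D. \<Sum>k\<in>A. \<Sum>l\<in>B. f k l p q)"
proof -
  have "(\<Sum>k\<in>A. \<Sum>l\<in>B. \<Sum>p\<in>C. \<Sum>q\<in>D. f k l p q) = (\<Sum>k\<in>A. \<Sum>p\<in>C. \<Sum>l\<in>B. \<Sum>q\<in>D. f k l p q)"
    by (intro sum.cong refl sum.swap)
  also have "\<dots> = (\<Sum>p\<in>C. \<Sum>k\<in>A. \<Sum>l\<in>B. \<Sum>q\<in>D. f k l p q)"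
    by (rule sum.swap)
  also have "\<dots> = (\<Sum>p\<in>C. \<Sum>k\<in>A. \<Sum>q\<in>D. \<Sum>l\<in>B. f k l p q)"
    by (intro sum.cong refl sum.swap)
  also have "\<dots> = (\<Sum>p\<in>C. \<Sum>q\<in>D. \<Sum>k\<in>A. \<Sum>l\<in>B. f k l p q)"
    by (intro sum.cong refl sum.swap)
  finally show ?thesis .
qed

text \<open>Kraus form: \<open>B\<close> is the sum over \<open>r\<close> of the adjoint of V_r
  times \<open>X\<close> times V_r. Its form at \<open>v\<close> is the sum of the forms of
  \<open>X\<close> at the vectors V_r v. Both partial traces and conditional operators have this
  shape.\<close>

lemma psd_kraus:
  assumes X: "psd N X" and B: "B \<in> carrier_mat n n"
    and kraus: "\<And>k l. k < n \<Longrightarrow> l < n \<Longrightarrow>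
      B $$ (k,l) = (\<Sum>r<R. \<Sum>p<N. \<Sum>q<N. cnj (V r p k) * X $$ (p,q) * V r q l)"
  shows "psd n B"
proof -
  have herm: "cnj (X $$ (q,p)) = X $$ (p,q)" if "p < N" "q < N" for p q
    using X that by (auto simp: psd_iff_herm_psd herm_psd_def)
  have pos: "0 \<le> Re (sesq N (\<lambda>p q. X $$ (p,q)) u)" for u
    using X by (auto simp: psd_iff_herm_psd herm_psd_def)
  have "cnj (B $$ (l,k)) = B $$ (k,l)" if "k < n" "l < n" for k l
  proof -
    have "cnj (B $$ (l,k)) = (\<Sum>r<R. \<Sum>p<N. \<Sum>q<N. V r p l * X $$ (q,p) * cnj (V r q k))"
      unfolding kraus[OF that(2,1)] by (auto simp: herm intro!: sum.cong)
    also have "\<dots> = B $$ (k,l)"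
      unfolding kraus[OF that] by (subst (2) sum.swap) (simp add: mult_ac)
    finally show ?thesis .
  qed
  moreover have "0 \<le> Re (sesq n (\<lambda>i j. B $$ (i,j)) v)" for v
  proof -
    let ?u = "\<lambda>r p. \<Sum>k<n. V r p k * v k"
    have "sesq n (\<lambda>i j. B $$ (i,j)) v = (\<Sum>k<n. \<Sum>l<n. \<Sum>r<R. \<Sum>p<N. \<Sum>q<N.
        cnj (v k * V r p k) * X $$ (p,q) * (V r q l * v l))"
      unfolding sesq_def sum_distrib_left
      by (intro sum.cong refl) (simp add: kraus sum_distrib_left sum_distrib_right mult_ac)
    also have "\<dots> = (\<Sum>r<R. \<Sum>k<n. \<Sum>l<n. \<Sum>p<N. \<Sum>q<N.
        cnj (v k * V r p k) * X $$ (p,q) * (V r q l * v l))"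
      by (subst sum.swap[of _ "{..<R}"], subst sum.swap[of _ "{..<R}"]) simp
    also have "\<dots> = (\<Sum>r<R. \<Sum>p<N. \<Sum>q<N. \<Sum>k<n. \<Sum>l<n.
        cnj (v k * V r p k) * X $$ (p,q) * (V r q l * v l))"
      by (intro sum.cong refl sum_swap_pairs)
    also have "\<dots> = (\<Sum>r<R. \<Sum>p<N. \<Sum>q<N. cnj (?u r p) * (X $$ (p,q) * ?u r q))"
      by (simp only: cnj_sum sum_distrib_left[of "X $$ _"] sum_product) (simp add: mult_ac)
    also have "\<dots> = (\<Sum>r<R. sesq N (\<lambda>p q. X $$ (p,q)) (?u r))"
      by (simp only: sesq_def sum_distrib_left[of "cnj _"])
    finally show ?thesis using pos by (simp add: sum_nonneg)
  qed
  ultimately show ?thesis using B by (simp add: psd_iff_herm_psd herm_psd_def)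
qed

section \<open>Block diagonal operators and linear maps\<close>

lemma sum_lessThan_add:
  fixes a b :: nat
  shows "(\<Sum>p<a + b. f p) = (\<Sum>p<a. f p) + (\<Sum>k<b. f (a + k))"
  by (induction b) (simp_all add: add.assoc)

lemma sum_lessThan_mult:
  fixes d m :: nat
  shows "(\<Sum>p<d * m. f p) = (\<Sum>i<d. \<Sum>k<m. f (i * m + k))"
proof (induction d)
  case (Suc d)
  then show ?case using sum_lessThan_add[of f "d * m" m] by (simp add: add.commute[of m])
qed simp

lemma less_mult_imp_div_mod_less:
  assumes "p < d * m"
  shows "p div m < d" "p mod m < (m :: nat)"
proof -
  have "0 < m" using assms by (cases m) auto
  then show "p div m < d" "p mod m < m"
    using assms by (auto simp: less_mult_imp_div_less)
qed

lemma mult_add_less_mult: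
  fixes d m i k :: nat
  assumes "i < d" "k < m"
  shows "i * m + k < d * m"
proof -
  have "i * m + k < Suc i * m" using assms by simp
  also have "\<dots> \<le> d * m" using assms by (intro mult_le_mono1) simp
  finally show ?thesis .
qed

definition block_diag :: "nat \<Rightarrow> nat \<Rightarrow> (nat \<Rightarrow> complex mat) \<Rightarrow> complex mat" where
  "block_diag d m B = mat (d * m) (d * m) (\<lambda>(p,q).
     if p div m = q div m then B (p div m) $$ (p mod m, q mod m) else 0)"

lemma block_diag_carrier [simp]: "block_diag d m B \<in> carrier_mat (d * m) (d * m)"
  by (simp add: block_diag_def)

text \<open>Splitting off the last block brings in the two-block rule for characteristic
  polynomials, so an induction on \<open>d\<close> becomes possible.\<close>

lemma block_diag_Suc:
  assumes B: "B d \<in> carrier_mat m m"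
  shows "block_diag (Suc d) m B
    = four_block_mat (block_diag d m B) (0\<^sub>m (d * m) m) (0\<^sub>m m (d * m)) (B d)"
proof (rule eq_matI, goal_cases)
  case (1 p q)
  have high: "r div m = d" "r mod m = r - d * m" if "\<not> r < d * m" "r < d * m + m" for r
  proof -
    have "r = d * m + (r - d * m)" "r - d * m < m" using that by auto
    then show "r div m = d" "r mod m = r - d * m"
      by (metis add.right_neutral div_less div_mult_self3 mod_less mod_mult_self3 less_nat_zero_code add.commute)+
  qed
  have pq: "p < d * m + m" "q < d * m + m"
    using 1 B carrier_matD[OF block_diag_carrier[of d m B]] by auto
  have dims: "dim_row (block_diag d m B) = d * m" "dim_col (block_diag d m B) = d * m"
    "dim_row (B d) = m" "dim_col (B d) = m"
    using B by (auto simp: block_diag_def)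
  have lhs: "block_diag (Suc d) m B $$ (p,q)
      = (if p div m = q div m then B (p div m) $$ (p mod m, q mod m) else 0)"
    using pq by (simp add: block_diag_def)
  have rhs: "four_block_mat (block_diag d m B) (0\<^sub>m (d * m) m) (0\<^sub>m m (d * m)) (B d) $$ (p,q)
      = (if p < d * m then if q < d * m then block_diag d m B $$ (p,q) else 0
         else if q < d * m then 0 else B d $$ (p - d * m, q - d * m))"
    using pq by (simp add: dims)
  consider "p < d * m" "q < d * m" | "p < d * m" "\<not> q < d * m"
    | "\<not> p < d * m" "q < d * m" | "\<not> p < d * m" "\<not> q < d * m" by blast
  then show ?case
  proof cases
    case 1
    then show ?thesis unfolding lhs rhs by (simp add: block_diag_def)
  next
    case 2
    then show ?thesis
      unfolding lhs rhs using high(1)[of q] pq less_mult_imp_div_mod_less(1)[of p d m] by simp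
  next
    case 3
    then show ?thesis
      unfolding lhs rhs using high(1)[of p] pq less_mult_imp_div_mod_less(1)[of q d m] by simp
  next
    case 4
    then show ?thesis unfolding lhs rhs using high[of p] high[of q] pq by simp
  qed
qed (use B in \<open>auto simp: block_diag_def\<close>)

lemma char_poly_block_diag:
  assumes "\<And>j. j < d \<Longrightarrow> B j \<in> carrier_mat m m"
  shows "char_poly (block_diag d m B) = (\<Prod>j<d. char_poly (B j))"
  using assms
proof (induction d)
  case 0
  show ?case by (simp add: char_poly_defs block_diag_def)
next
  case (Suc d)
  have Bd: "B d \<in> carrier_mat m m" using Suc.prems by simp
  \<comment> \<open>The two-block rule asks for both characteristic polynomials to split into linear
    factors, which holds over the complex numbers.\<close>
  have "char_poly (block_diag (Suc d) m B) = char_poly (block_diag d m B) * char_poly (B d)"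
    by (rule char_poly_0_block[OF block_diag_Suc[of B d m, OF Bd] _ _ block_diag_carrier _ Bd])
      (use char_poly_factorized[OF Bd] char_poly_factorized[OF block_diag_carrier[of d m B]] in auto)
  then show ?case using Suc by simp
qed

section \<open>Classical-quantum operators and their entropy\<close>

definition orthonormal :: "nat \<Rightarrow> (nat \<Rightarrow> complex vec) \<Rightarrow> bool" where
  "orthonormal d e \<longleftrightarrow> (\<forall>j<d. e j \<in> carrier_vec d) \<and>
     (\<forall>i<d. \<forall>j<d. cinner (e i) (e j) = (if i = j then 1 else 0))"

text \<open>The operator \<open>\<Sum>\<^sub>a |e\<^sub>a\<rangle>\<langle>e\<^sub>a| \<otimes> B\<^sub>a\<close>.\<close>
definition classical_quantum ::
    "nat \<Rightarrow> nat \<Rightarrow> (nat \<Rightarrow> complex vec) \<Rightarrow> (nat \<Rightarrow> complex mat) \<Rightarrow> complex mat" where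
  "classical_quantum d m e B = mat (d * m) (d * m) (\<lambda>(p,q).
     \<Sum>a<d. e a $ (p div m) * cnj (e a $ (q div m)) * B a $$ (p mod m, q mod m))"

lemma similar_classical_quantum_block_diag:
  assumes e: "orthonormal d e"
  shows "similar_mat (classical_quantum d m e B) (block_diag d m B)"
proof -
  \<comment> \<open>\<open>W\<close> is U tensor I, where U has the vectors \<open>e a\<close> as
    columns, and \<open>V\<close> is its adjoint. They change between the standard basis and the
    basis \<open>e\<close> on the first factor.\<close>
  define W where "W = mat (d * m) (d * m)
    (\<lambda>(p,q). e (q div m) $ (p div m) * (if q mod m = p mod m then 1 else 0))"
  define V where "V = mat (d * m) (d * m)
    (\<lambda>(p,q). cnj (e (p div m) $ (q div m)) * (if p mod m = q mod m then 1 else 0))"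
  have W: "W \<in> carrier_mat (d * m) (d * m)" and V: "V \<in> carrier_mat (d * m) (d * m)"
    by (auto simp: W_def V_def)
  have "V * W = 1\<^sub>m (d * m)"
  proof (rule eq_matI, goal_cases)
    case (1 p q)
    then have pq: "p < d * m" "q < d * m" by auto
    note dm = less_mult_imp_div_mod_less[OF pq(1)] less_mult_imp_div_mod_less[OF pq(2)]
    have "(V * W) $$ (p,q) = (\<Sum>r<d * m. V $$ (p,r) * W $$ (r,q))"
      using pq V W by (simp add: scalar_prod_def lessThan_atLeast0)
    also have "\<dots> = (\<Sum>i<d. \<Sum>k<m. cnj (e (p div m) $ i) * (if p mod m = k then 1 else 0)
        * (e (q div m) $ i * (if q mod m = k then 1 else 0)))"
      unfolding sum_lessThan_mult using pq
      by (intro sum.cong refl) (simp add: V_def W_def mult_add_less_mult)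
    also have "\<dots> = (\<Sum>i<d. \<Sum>k<m. if k = p mod m then
        cnj (e (p div m) $ i) * (e (q div m) $ i * (if q mod m = p mod m then 1 else 0)) else 0)"
      by (intro sum.cong refl) auto
    also have "\<dots> = (\<Sum>i<d. cnj (e (p div m) $ i) * e (q div m) $ i) * (if q mod m = p mod m then 1 else 0)"
      using dm by (simp add: sum_distrib_right mult.assoc)
    also have "(\<Sum>i<d. cnj (e (p div m) $ i) * e (q div m) $ i) = (if p div m = q div m then 1 else 0)"
    proof -
      have "cinner (e (p div m)) (e (q div m)) = (if p div m = q div m then 1 else 0)"
        "dim_vec (e (q div m)) = d"
        using e dm by (auto simp: orthonormal_def)
      then show ?thesis by (simp add: cinner_def)
    qed
    also have "(if p div m = q div m then 1 else 0) * (if q mod m = p mod m then 1 else 0)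
        = (1\<^sub>m (d * m) $$ (p,q) :: complex)"
      using pq by (auto, metis div_mult_mod_eq)
    finally show ?case .
  qed (use V W in auto)
  \<comment> \<open>A one-sided inverse of a square matrix is two-sided; in terms of
    \<open>e\<close>, orthonormality of \<open>d\<close> vectors implies completeness.\<close>
  moreover from this have "W * V = 1\<^sub>m (d * m)"
    using mat_mult_left_right_inverse[OF V W] by simp
  moreover have "classical_quantum d m e B = W * block_diag d m B * V"
  proof (rule eq_matI, goal_cases)
    case (1 p q)
    then have pq: "p < d * m" "q < d * m" using W V by auto
    note dm = less_mult_imp_div_mod_less[OF pq(1)] less_mult_imp_div_mod_less[OF pq(2)]
    have WD: "(W * block_diag d m B) $$ (p,s) = e (s div m) $ (p div m) * B (s div m) $$ (p mod m, s mod m)"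
      if s: "s < d * m" for s
    proof -
      note sm = less_mult_imp_div_mod_less[OF s]
      have "(W * block_diag d m B) $$ (p,s) = (\<Sum>r<d * m. W $$ (p,r) * block_diag d m B $$ (r,s))"
        using pq s W by (simp add: scalar_prod_def lessThan_atLeast0 block_diag_def)
      also have "\<dots> = (\<Sum>a<d. \<Sum>k<m. e a $ (p div m) * (if k = p mod m then 1 else 0)
          * (if a = s div m then B a $$ (k, s mod m) else 0))"
        unfolding sum_lessThan_mult using pq s
        by (intro sum.cong refl) (simp add: W_def block_diag_def mult_add_less_mult)
      also have "\<dots> = (\<Sum>a<d. \<Sum>k<m. if k = p mod m then
          (if a = s div m then e a $ (p div m) * B a $$ (p mod m, s mod m) else 0) else 0)"
        by (intro sum.cong refl) auto
      also have "\<dots> = e (s div m) $ (p div m) * B (s div m) $$ (p mod m, s mod m)"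
        using dm sm by simp
      finally show ?thesis .
    qed
    have "(W * block_diag d m B * V) $$ (p,q) = (\<Sum>s<d * m. (W * block_diag d m B) $$ (p,s) * V $$ (s,q))"
      using pq W V
      by (simp add: scalar_prod_def lessThan_atLeast0 block_diag_def del: index_mult_mat(1))
        (simp add: scalar_prod_def lessThan_atLeast0)
    also have "\<dots> = (\<Sum>a<d. \<Sum>l<m. e a $ (p div m) * B a $$ (p mod m, l)
        * (cnj (e a $ (q div m)) * (if l = q mod m then 1 else 0)))"
      unfolding sum_lessThan_mult using pq
      by (intro sum.cong refl) (simp add: WD V_def mult_add_less_mult del: index_mult_mat(1))
    also have "\<dots> = (\<Sum>a<d. \<Sum>l<m. if l = q mod m then
        e a $ (p div m) * cnj (e a $ (q div m)) * B a $$ (p mod m, q mod m) else 0)"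
      by (intro sum.cong refl) auto
    also have "\<dots> = classical_quantum d m e B $$ (p,q)"
      using dm pq by (simp add: classical_quantum_def)
    finally show ?case by simp
  qed (use V W in \<open>auto simp: classical_quantum_def\<close>)
  ultimately show ?thesis
    using W V by (intro similar_matI[of _ _ W V "d * m"]) (auto simp: classical_quantum_def)
qed

text \<open>Similarity preserves the characteristic polynomial, which for block diagonal matrices is
  a product, and \<open>poly_entropy\<close> turns products into sums. The blocks may be
  unnormalised, in which case the Shannon term is contained in the summands.\<close>

lemma vn_entropy_classical_quantum:
  assumes "orthonormal d e" "\<And>j. j < d \<Longrightarrow> B j \<in> carrier_mat m m"
  shows "vn_entropy (classical_quantum d m e B) = (\<Sum>j<d. vn_entropy (B j))"
proof -
  have "char_poly (classical_quantum d m e B) = (\<Prod>j<d. char_poly (B j))"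
    using char_poly_similar[OF similar_classical_quantum_block_diag[OF assms(1)]]
      char_poly_block_diag[OF assms(2)] by simp
  then show ?thesis
    using assms(2) char_poly_nonzero
    by (simp add: vn_entropy_char_poly) (rule poly_entropy_prod, auto)
qed

section \<open>Linear maps and channels evaluated on matrix units\<close>

lemma unit_mat_carrier [simp]: "unit_mat n i j \<in> carrier_mat n n"
  by (simp add: unit_mat_def)

lemma linear_mapD:
  assumes "Defs.linear_map n F"
  shows "A \<in> carrier_mat n n \<Longrightarrow> F A \<in> carrier_mat n n"
    "A \<in> carrier_mat n n \<Longrightarrow> B \<in> carrier_mat n n \<Longrightarrow> F (A + B) = F A + F B"
    "A \<in> carrier_mat n n \<Longrightarrow> F (c \<cdot>\<^sub>m A) = c \<cdot>\<^sub>m F A"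
  using assms by (simp_all add: Defs.linear_map_def)

lemma linear_map_sum:
  assumes F: "Defs.linear_map n F" and "finite S" and "\<And>s. s \<in> S \<Longrightarrow> Y s \<in> carrier_mat n n"
    and pq: "p < n" "q < n"
  shows "F (mat n n (\<lambda>ij. \<Sum>s\<in>S. c s * Y s $$ ij)) $$ (p,q) = (\<Sum>s\<in>S. c s * F (Y s) $$ (p,q))"
  using assms(2,3)
proof (induction S rule: finite_induct)
  case empty
  \<comment> \<open>The zero matrix is written as 0 times itself so that homogeneity makes its image
    vanish.\<close>
  have "mat n n (\<lambda>ij. \<Sum>s\<in>{}. c s * Y s $$ ij) = (0 :: complex) \<cdot>\<^sub>m 0\<^sub>m n n"
    by auto
  moreover have "F ((0 :: complex) \<cdot>\<^sub>m 0\<^sub>m n n) = (0 :: complex) \<cdot>\<^sub>m F (0\<^sub>m n n)"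
    "F (0\<^sub>m n n) \<in> carrier_mat n n"
    using F by (auto simp: Defs.linear_map_def simp del: smult_zero_mat)
  ultimately show ?case using pq by (simp del: smult_zero_mat)
next
  case (insert t S)
  let ?R = "mat n n (\<lambda>ij. \<Sum>s\<in>S. c s * Y s $$ ij)"
  have Y: "Y t \<in> carrier_mat n n" using insert by simp
  have R: "?R \<in> carrier_mat n n" by simp
  have "mat n n (\<lambda>ij. \<Sum>s\<in>insert t S. c s * Y s $$ ij) = c t \<cdot>\<^sub>m Y t + ?R"
    using insert carrier_matD[OF Y] by (intro eq_matI) auto
  moreover have "F (c t \<cdot>\<^sub>m Y t + ?R) = c t \<cdot>\<^sub>m F (Y t) + F ?R"
    by (simp only: linear_mapD[OF F] Y R smult_carrier_mat)
  moreover have "F (Y t) \<in> carrier_mat n n" "F ?R \<in> carrier_mat n n"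
    by (simp_all only: linear_mapD[OF F] Y R)
  ultimately show ?case using insert pq by simp
qed

text \<open>\<open>tensor_map\<close> sees its factors only on matrix units; this expansion recovers
  the value of a linear map on a general operator from them.\<close>

lemma linear_map_unit_mat_expansion:
  assumes F: "Defs.linear_map n F" and X: "X \<in> carrier_mat n n" and pq: "p < n" "q < n"
  shows "F X $$ (p,q) = (\<Sum>k<n. \<Sum>l<n. X $$ (k,l) * F (unit_mat n k l) $$ (p,q))"
proof -
  let ?S = "{..<n} \<times> {..<n}"
  have "X = mat n n (\<lambda>ij. \<Sum>s\<in>?S. X $$ s * unit_mat n (fst s) (snd s) $$ ij)"
  proof (rule eq_matI, goal_cases)
    case (1 i j)
    then have "(\<Sum>s\<in>?S. X $$ s * unit_mat n (fst s) (snd s) $$ (i,j)) = (\<Sum>s\<in>?S. if s = (i,j) then X $$ s else 0)"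
      by (intro sum.cong) (auto simp: unit_mat_def)
    then show ?case using 1 by simp
  qed (use X in auto)
  then have "F X $$ (p,q) = F (mat n n (\<lambda>ij. \<Sum>s\<in>?S. X $$ s * unit_mat n (fst s) (snd s) $$ ij)) $$ (p,q)"
    by simp
  also have "\<dots> = (\<Sum>s\<in>?S. X $$ s * F (unit_mat n (fst s) (snd s)) $$ (p,q))"
    by (rule linear_map_sum[OF F _ _ pq]) auto
  also have "\<dots> = (\<Sum>k<n. \<Sum>l<n. X $$ (k,l) * F (unit_mat n k l) $$ (p,q))"
    by (simp add: sum.cartesian_product split_def)
  finally show ?thesis .
qed

text \<open>Positivity is complete positivity with a one-dimensional ancilla:
  \<open>tensor_map 1 n\<close> of the identity and \<open>F\<close> agrees with
  \<open>F\<close>.\<close>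

lemma channel_density:
  assumes F: "channel n F" and A: "density n A"
  shows "density n (F A)"
proof -
  have lin: "Defs.linear_map n F" and cp: "completely_positive n F" and tp: "trace_preserving n F"
    using F by (auto simp: channel_def)
  have carr: "A \<in> carrier_mat n n" and psd: "psd n A" using A by (auto simp: density_def psd_def)
  have FA: "F A \<in> carrier_mat n n" using lin carr by (simp add: Defs.linear_map_def)
  have "tensor_map 1 n (\<lambda>A. A) F A = F A"
  proof (rule eq_matI, goal_cases)
    case (1 p q)
    then have pq: "p < n" "q < n" using FA by auto
    then show ?case
      by (simp add: tensor_map_def unit_mat_def[of "Suc 0"] linear_map_unit_mat_expansion[OF lin carr pq])
  qed (use FA in \<open>auto simp: tensor_map_def\<close>)
  moreover have "psd n (tensor_map 1 n (\<lambda>A. A) F A)"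
    using cp psd unfolding completely_positive_def by (metis mult_1)
  ultimately show ?thesis
    using tp carr A by (simp add: density_def trace_preserving_def)
qed

section \<open>Conditional states and the entropy splitting\<close>

text \<open>The unnormalised conditional state \<open>Tr\<^sub>H ((A \<otimes> I) X)\<close>.\<close>
definition cond_op :: "nat \<Rightarrow> nat \<Rightarrow> complex mat \<Rightarrow> complex mat \<Rightarrow> complex mat" where
  "cond_op d m A X = mat m m (\<lambda>(k,l). \<Sum>i<d. \<Sum>j<d. A $$ (j,i) * X $$ (i * m + k, j * m + l))"

lemma cond_op_carrier [simp]: "cond_op d m A X \<in> carrier_mat m m"
  by (simp add: cond_op_def)

text \<open>Writing \<open>A\<close> as a sum of projectors |w_r><w_r| (unnormalised) puts the
  conditional operator into Kraus form with V_r = |w_r> tensor I.\<close>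

lemma psd_cond_op:
  assumes A: "psd d A" and X: "psd (d * m) X"
  shows "psd m (cond_op d m A X)"
proof -
  obtain w where w: "\<forall>i<d. \<forall>j<d. A $$ (i,j) = (\<Sum>r<d. w r i * cnj (w r j))"
    using psd_rank_one_sum[OF A] by blast
  define V where "V = (\<lambda>r p k. w r (p div m) * (if p mod m = k then 1 else 0 :: complex))"
  show ?thesis
  proof (rule psd_kraus[OF X cond_op_carrier])
    fix k l assume kl: "k < m" "l < m"
    have "(\<Sum>r<d. \<Sum>p<d * m. \<Sum>q<d * m. cnj (V r p k) * X $$ (p,q) * V r q l)
        = (\<Sum>r<d. \<Sum>i<d. \<Sum>k'<m. \<Sum>j<d. \<Sum>l'<m. if l' = l then
            (if k' = k then cnj (w r i) * X $$ (i * m + k, j * m + l) * w r j else 0) else 0)"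
      unfolding sum_lessThan_mult by (intro sum.cong refl) (auto simp: V_def)
    also have "\<dots> = (\<Sum>r<d. \<Sum>i<d. \<Sum>k'<m. if k' = k then
        (\<Sum>j<d. cnj (w r i) * X $$ (i * m + k, j * m + l) * w r j) else 0)"
      using kl by (intro sum.cong refl) auto
    also have "\<dots> = (\<Sum>r<d. \<Sum>i<d. \<Sum>j<d. cnj (w r i) * X $$ (i * m + k, j * m + l) * w r j)"
      using kl by simp
    also have "\<dots> = (\<Sum>i<d. \<Sum>r<d. \<Sum>j<d. cnj (w r i) * X $$ (i * m + k, j * m + l) * w r j)"
      by (rule sum.swap)
    also have "\<dots> = (\<Sum>i<d. \<Sum>j<d. \<Sum>r<d. cnj (w r i) * X $$ (i * m + k, j * m + l) * w r j)"
      by (intro sum.cong refl sum.swap)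
    also have "\<dots> = cond_op d m A X $$ (k,l)"
      using kl w by (auto simp: cond_op_def sum_distrib_right mult_ac intro!: sum.cong)
    finally show "cond_op d m A X $$ (k,l)
        = (\<Sum>r<d. \<Sum>p<d * m. \<Sum>q<d * m. cnj (V r p k) * X $$ (p,q) * V r q l)" by simp
  qed
qed

text \<open>The trace of a conditional operator is an outcome probability of the marginal on the
  first factor; this links the blocks of the joint output to the output of the measurement
  channel.\<close>

lemma mtrace_cond_op:
  assumes A: "A \<in> carrier_mat d d"
  shows "mtrace (cond_op d m A X) = mtrace (A * ptrace2 d m X)"
proof -
  have "mtrace (A * ptrace2 d m X) = (\<Sum>j<d. \<Sum>i<d. A $$ (j,i) * (\<Sum>k<m. X $$ (i * m + k, j * m + k)))"
    using A by (simp add: mtrace_def scalar_prod_def lessThan_atLeast0 ptrace2_def)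
  also have "\<dots> = (\<Sum>j<d. \<Sum>i<d. \<Sum>k<m. A $$ (j,i) * X $$ (i * m + k, j * m + k))"
    by (simp add: sum_distrib_left)
  also have "\<dots> = (\<Sum>i<d. \<Sum>j<d. \<Sum>k<m. A $$ (j,i) * X $$ (i * m + k, j * m + k))"
    by (rule sum.swap)
  also have "\<dots> = (\<Sum>i<d. \<Sum>k<m. \<Sum>j<d. A $$ (j,i) * X $$ (i * m + k, j * m + k))"
    by (intro sum.cong refl sum.swap)
  also have "\<dots> = (\<Sum>k<m. \<Sum>i<d. \<Sum>j<d. A $$ (j,i) * X $$ (i * m + k, j * m + k))"
    by (rule sum.swap)
  also have "\<dots> = mtrace (cond_op d m A X)"
    by (simp add: mtrace_def cond_op_def)
  finally show ?thesis by simp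
qed

lemma ptrace1_carrier [simp]: "ptrace1 d m X \<in> carrier_mat m m"
  by (simp add: ptrace1_def)

lemma mtrace_ptrace2:
  assumes "X \<in> carrier_mat (d * m) (d * m)"
  shows "mtrace (ptrace2 d m X) = mtrace X"
  using assms by (simp add: mtrace_def ptrace2_def sum_lessThan_mult)

lemma density_ptrace2:
  assumes X: "density (d * m) X"
  shows "density d (ptrace2 d m X)"
proof -
  have psd: "psd (d * m) X" and carr: "X \<in> carrier_mat (d * m) (d * m)"
    using X by (auto simp: density_def psd_def)
  have "psd d (ptrace2 d m X)"
  proof (rule psd_kraus[OF psd])
    fix a b assume ab: "a < d" "b < d"
    \<comment> \<open>The Kraus operators of the partial trace are I tensor |r>, for
      \<open>r\<close> running over the basis of the second factor.\<close>
    let ?V = "\<lambda>r p a. if p div m = a \<and> p mod m = r then 1 else 0 :: complex"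
    have "(\<Sum>r<m. \<Sum>p<d * m. \<Sum>q<d * m. cnj (?V r p a) * X $$ (p,q) * ?V r q b)
        = (\<Sum>r<m. \<Sum>i<d. \<Sum>k<m. \<Sum>j<d. \<Sum>l<m. if l = r then if j = b then if k = r then if i = a then
            X $$ (a * m + r, b * m + r) else 0 else 0 else 0 else 0)"
      unfolding sum_lessThan_mult by (intro sum.cong refl) auto
    also have "\<dots> = (\<Sum>r<m. X $$ (a * m + r, b * m + r))"
      using ab by (intro sum.cong refl) simp
    finally show "ptrace2 d m X $$ (a,b)
        = (\<Sum>r<m. \<Sum>p<d * m. \<Sum>q<d * m. cnj (?V r p a) * X $$ (p,q) * ?V r q b)"
      using ab by (simp add: ptrace2_def)
  qed (simp add: ptrace2_def)
  then show ?thesis using X mtrace_ptrace2[OF carr] by (simp add: density_def)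
qed

section \<open>Convex decompositions and bounds on \<open>H_map\<close>\<close>

definition decomposition ::
    "nat \<Rightarrow> complex mat \<Rightarrow> nat \<Rightarrow> (nat \<Rightarrow> real) \<Rightarrow> (nat \<Rightarrow> complex mat) \<Rightarrow> bool" where
  "decomposition n \<sigma> N p s \<longleftrightarrow> (\<forall>j<N. 0 \<le> p j \<and> density n (s j)) \<and> (\<Sum>j<N. p j) = 1 \<and>
     (\<forall>a<n. \<forall>b<n. \<sigma> $$ (a,b) = (\<Sum>j<N. complex_of_real (p j) * s j $$ (a,b)))"

lemma H_map_decomposition:
  "H_map n F \<sigma> = Inf {(\<Sum>j<N. p j * vn_entropy (F (s j))) | N p s. decomposition n \<sigma> N p s}"
  by (simp add: H_map_def decomposition_def)

text \<open>An infimum of reals lies below a member only if the set is bounded below; nonnegative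
  output entropies provide the bound 0.\<close>

lemma H_map_le:
  assumes dec: "decomposition n \<sigma> N p s"
    and nonneg: "\<And>s. density n s \<Longrightarrow> 0 \<le> vn_entropy (F s)"
  shows "H_map n F \<sigma> \<le> (\<Sum>j<N. p j * vn_entropy (F (s j)))"
  unfolding H_map_decomposition
proof (rule cInf_lower)
  show "bdd_below {(\<Sum>j<N. p j * vn_entropy (F (s j))) | N p s. decomposition n \<sigma> N p s}"
    by (rule bdd_belowI[of _ 0]) (auto simp: decomposition_def nonneg intro!: sum_nonneg)
qed (use dec in blast)

lemma H_map_ge:
  assumes \<sigma>: "density n \<sigma>"
    and bound: "\<And>N p s. decomposition n \<sigma> N p s \<Longrightarrow> c \<le> (\<Sum>j<N. p j * vn_entropy (F (s j)))"
  shows "c \<le> H_map n F \<sigma>"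
  unfolding H_map_decomposition
proof (rule cInf_greatest)
  \<comment> \<open>The one-term decomposition of the state into itself shows that the infimum is
    over a nonempty set.\<close>
  have "decomposition n \<sigma> 1 (\<lambda>_. 1) (\<lambda>_. \<sigma>)"
    using \<sigma> by (simp add: decomposition_def)
  then show "{(\<Sum>j<N. p j * vn_entropy (F (s j))) | N p s. decomposition n \<sigma> N p s} \<noteq> {}"
    by blast
qed (use bound in blast)

text \<open>The index pair \<open>(i,a)\<close> is encoded as \<open>i * d + a\<close>.\<close>
lemma decomposition_refine:
  assumes p: "\<forall>i<N. 0 \<le> p i" "(\<Sum>i<N. p i) = 1"
    and \<tau>: "\<And>a b. a < n \<Longrightarrow> b < n \<Longrightarrow> \<sigma> $$ (a,b) = (\<Sum>i<N. complex_of_real (p i) * \<tau> i $$ (a,b))"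
    and dec: "\<And>i. i < N \<Longrightarrow> decomposition n (\<tau> i) d (q i) (s i)"
  shows "decomposition n \<sigma> (N * d) (\<lambda>r. p (r div d) * q (r div d) (r mod d))
    (\<lambda>r. s (r div d) (r mod d))"
  unfolding decomposition_def
proof (intro conjI allI impI)
  fix r assume r: "r < N * d"
  note less_mult_imp_div_mod_less[OF r]
  then show "0 \<le> p (r div d) * q (r div d) (r mod d)" "density n (s (r div d) (r mod d))"
    using p(1) dec[of "r div d"] by (auto simp: decomposition_def)
next
  have "(\<Sum>r<N * d. p (r div d) * q (r div d) (r mod d)) = (\<Sum>i<N. p i * (\<Sum>a<d. q i a))"
    unfolding sum_lessThan_mult sum_distrib_left by (intro sum.cong refl) simp
  also have "\<dots> = (\<Sum>i<N. p i)"
    using dec by (intro sum.cong refl) (simp add: decomposition_def)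
  finally show "(\<Sum>r<N * d. p (r div d) * q (r div d) (r mod d)) = 1" using p(2) by simp
next
  fix a b assume ab: "a < n" "b < n"
  have "(\<Sum>r<N * d. complex_of_real (p (r div d) * q (r div d) (r mod d)) * s (r div d) (r mod d) $$ (a,b))
      = (\<Sum>i<N. complex_of_real (p i) * (\<Sum>c<d. complex_of_real (q i c) * s i c $$ (a,b)))"
    unfolding sum_lessThan_mult sum_distrib_left by (intro sum.cong refl) simp
  also have "\<dots> = (\<Sum>i<N. complex_of_real (p i) * \<tau> i $$ (a,b))"
    using dec ab by (intro sum.cong refl) (simp add: decomposition_def)
  finally show "\<sigma> $$ (a,b) = (\<Sum>r<N * d. complex_of_real (p (r div d) * q (r div d) (r mod d))
      * s (r div d) (r mod d) $$ (a,b))"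
    using \<tau>[OF ab] by simp
qed

lemma sum_rotate: "(\<Sum>i\<in>A. \<Sum>j\<in>B. \<Sum>c\<in>C. f i j c) = (\<Sum>c\<in>C. \<Sum>i\<in>A. \<Sum>j\<in>B. f i j c)"
proof -
  have "(\<Sum>i\<in>A. \<Sum>j\<in>B. \<Sum>c\<in>C. f i j c) = (\<Sum>i\<in>A. \<Sum>c\<in>C. \<Sum>j\<in>B. f i j c)"
    by (intro sum.cong refl sum.swap)
  also have "\<dots> = (\<Sum>c\<in>C. \<Sum>i\<in>A. \<Sum>j\<in>B. f i j c)"
    by (rule sum.swap)
  finally show ?thesis .
qed

section \<open>The quantum-classical channel of a measurement\<close>

locale qc_measurement =
  fixes d :: nat and M :: "nat \<Rightarrow> complex mat" and e :: "nat \<Rightarrow> complex vec"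
  assumes M_psd: "\<And>j. j < d \<Longrightarrow> psd d (M j)"
    and M_sum: "\<And>a b. a < d \<Longrightarrow> b < d \<Longrightarrow> (\<Sum>j<d. M j $$ (a,b)) = (if a = b then 1 else 0)"
    and e_orthonormal: "orthonormal d e"
begin

lemma M_carrier: "j < d \<Longrightarrow> M j \<in> carrier_mat d d"
  using M_psd by (auto simp: psd_def)

text \<open>The output is a classical-quantum operator whose second factor is one-dimensional, the
  blocks being the outcome probabilities; its entropy is their Shannon entropy.\<close>

lemma vn_entropy_qc_channel:
  "vn_entropy (qc_channel d M e \<sigma>) = - (\<Sum>j<d. xlnx (mtrace (M j * \<sigma>)))"
proof -
  have "qc_channel d M e \<sigma> = classical_quantum d 1 e (\<lambda>j. mat 1 1 (\<lambda>_. mtrace (M j * \<sigma>)))"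
    by (auto simp: qc_channel_def classical_quantum_def mult_ac intro!: eq_matI sum.cong)
  then have "vn_entropy (qc_channel d M e \<sigma>) = (\<Sum>j<d. vn_entropy (mat 1 1 (\<lambda>_. mtrace (M j * \<sigma>))))"
    by (simp only:) (rule vn_entropy_classical_quantum[OF e_orthonormal], auto)
  then show ?thesis by (simp only: vn_entropy_one_by_one sum_negf)
qed

text \<open>Completeness of the measurement: summing over \<open>a\<close> replaces
  \<open>M a\<close> by the identity, which leaves the plain partial trace over the first
  factor.\<close>

lemma sum_cond_op:
  assumes "k < m" "l < m"
  shows "(\<Sum>a<d. cond_op d m (M a) X $$ (k,l)) = ptrace1 d m X $$ (k,l)"
proof -
  have "(\<Sum>a<d. cond_op d m (M a) X $$ (k,l))
      = (\<Sum>a<d. \<Sum>i<d. \<Sum>j<d. M a $$ (j,i) * X $$ (i * m + k, j * m + l))"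
    using assms by (simp add: cond_op_def)
  also have "\<dots> = (\<Sum>i<d. \<Sum>a<d. \<Sum>j<d. M a $$ (j,i) * X $$ (i * m + k, j * m + l))"
    by (rule sum.swap)
  also have "\<dots> = (\<Sum>i<d. \<Sum>j<d. \<Sum>a<d. M a $$ (j,i) * X $$ (i * m + k, j * m + l))"
    by (intro sum.cong refl sum.swap)
  also have "\<dots> = (\<Sum>i<d. \<Sum>j<d. if j = i then X $$ (i * m + k, i * m + l) else 0)"
    by (intro sum.cong refl) (auto simp: M_sum simp flip: sum_distrib_right)
  also have "\<dots> = ptrace1 d m X $$ (k,l)"
    using assms by (simp add: ptrace1_def)
  finally show ?thesis .
qed

lemma mtrace_ptrace1:
  assumes "X \<in> carrier_mat (d * m) (d * m)"
  shows "mtrace (ptrace1 d m X) = mtrace X"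
proof -
  have "mtrace (ptrace1 d m X) = (\<Sum>k<m. \<Sum>i<d. X $$ (i * m + k, i * m + k))"
    by (simp add: mtrace_def ptrace1_def)
  also have "\<dots> = (\<Sum>i<d. \<Sum>k<m. X $$ (i * m + k, i * m + k))"
    by (rule sum.swap)
  finally show ?thesis using assms by (simp add: mtrace_def sum_lessThan_mult)
qed

lemma sum_mtrace_cond_op:
  assumes "X \<in> carrier_mat (d * m) (d * m)"
  shows "(\<Sum>a<d. mtrace (cond_op d m (M a) X)) = mtrace X"
proof -
  have "(\<Sum>a<d. mtrace (cond_op d m (M a) X)) = (\<Sum>a<d. \<Sum>k<m. cond_op d m (M a) X $$ (k,k))"
    unfolding mtrace_def by (simp add: carrier_matD[OF cond_op_carrier])
  also have "\<dots> = (\<Sum>k<m. \<Sum>a<d. cond_op d m (M a) X $$ (k,k))"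
    by (rule sum.swap)
  also have "\<dots> = mtrace (ptrace1 d m X)"
    unfolding mtrace_def using carrier_matD[of "ptrace1 d m X" m m] by (simp add: sum_cond_op ptrace1_carrier)
  finally show ?thesis using mtrace_ptrace1[OF assms] by simp
qed

text \<open>The outcome probabilities are nonnegative with sum 1, so each term x ln x is
  nonpositive. Working with them directly avoids proving that \<open>qc_channel\<close> is
  completely positive.\<close>

lemma vn_entropy_qc_channel_nonneg:
  assumes \<sigma>: "density d \<sigma>"
  shows "0 \<le> vn_entropy (qc_channel d M e \<sigma>)"
proof -
  \<comment> \<open>The state is regarded as a state with a one-dimensional second factor, so that
    the facts about \<open>cond_op\<close> apply with \<open>m = 1\<close>.\<close>
  have carr: "\<sigma> \<in> carrier_mat (d * 1) (d * 1)" and psd: "psd (d * 1) \<sigma>" and tr: "mtrace \<sigma> = 1"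
    using \<sigma> by (auto simp: density_def psd_def)
  have "ptrace2 d 1 \<sigma> = \<sigma>" using carr by (auto simp: ptrace2_def)
  then have q: "mtrace (M a * \<sigma>) = mtrace (cond_op d 1 (M a) \<sigma>)" if "a < d" for a
    using mtrace_cond_op[OF M_carrier[OF that], of 1 \<sigma>] by simp
  have nonneg: "0 \<le> Re (mtrace (M a * \<sigma>))" if "a < d" for a
    unfolding q[OF that] by (rule mtrace_psd(2)[OF psd_cond_op[OF M_psd[OF that] psd]])
  have "(\<Sum>a<d. mtrace (M a * \<sigma>)) = 1"
    using sum_mtrace_cond_op[OF carr] tr q by simp
  then have "(\<Sum>a<d. Re (mtrace (M a * \<sigma>))) = 1"
    by (metis Re_sum one_complex.simps(1))
  then have "Re (mtrace (M a * \<sigma>)) \<le> 1" if "a < d" for a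
    using member_le_sum[of a "{..<d}" "\<lambda>a. Re (mtrace (M a * \<sigma>))"] nonneg that by auto
  then have "xlnx (mtrace (M a * \<sigma>)) \<le> 0" if "a < d" for a
    using nonneg[OF that] that by (auto simp: xlnx_def mult_nonneg_nonpos)
  then show ?thesis
    unfolding vn_entropy_qc_channel by (auto intro!: sum_nonpos)
qed

lemma qc_channel_unit_mat:
  assumes "i < d" "j < d" "a < d" "b < d"
  shows "qc_channel d M e (unit_mat d i j) $$ (a,b) = (\<Sum>c<d. M c $$ (j,i) * (e c $ a * cnj (e c $ b)))"
proof -
  have "mtrace (M c * unit_mat d i j) = M c $$ (j,i)" if c: "c < d" for c
  proof -
    have "mtrace (M c * unit_mat d i j) = (\<Sum>r<d. \<Sum>s<d. M c $$ (r,s) * unit_mat d i j $$ (s,r))"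
      using M_carrier[OF c] by (simp add: mtrace_def scalar_prod_def lessThan_atLeast0 unit_mat_def)
    also have "\<dots> = (\<Sum>r<d. \<Sum>s<d. if s = i then if r = j then M c $$ (j,i) else 0 else 0)"
      by (intro sum.cong refl) (auto simp: unit_mat_def)
    finally show ?thesis using assms by simp
  qed
  then show ?thesis using assms by (simp add: qc_channel_def)
qed

text \<open>The trace of \<open>M c\<close> against the unit (i,j) is entry (j,i) of
  \<open>M c\<close>. Hence, for fixed \<open>c\<close>, the sums over \<open>i\<close> and
  \<open>j\<close> assemble \<open>cond_op\<close>, and those over \<open>k\<close> and
  \<open>l\<close> rebuild \<open>\<Omega>\<close> on it by linearity.\<close>

lemma tensor_map_qc_channel:
  assumes \<Omega>: "Defs.linear_map m \<Omega>"
  shows "tensor_map d m (qc_channel d M e) \<Omega> X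
    = classical_quantum d m e (\<lambda>a. \<Omega> (cond_op d m (M a) X))"
proof (rule eq_matI, goal_cases)
  case (1 p q)
  then have pq: "p < d * m" "q < d * m" by (auto simp: classical_quantum_def)
  note dm = less_mult_imp_div_mod_less[OF pq(1)] less_mult_imp_div_mod_less[OF pq(2)]
  let ?E = "\<lambda>c. e c $ (p div m) * cnj (e c $ (q div m))"
  let ?F = "\<lambda>k l. \<Omega> (unit_mat m k l) $$ (p mod m, q mod m)"
  let ?f = "\<lambda>c i j k l. ?E c * (M c $$ (j,i) * X $$ (i * m + k, j * m + l) * ?F k l)"
  have "tensor_map d m (qc_channel d M e) \<Omega> X $$ (p,q) = (\<Sum>i<d. \<Sum>j<d. \<Sum>k<m. \<Sum>l<m. \<Sum>c<d. ?f c i j k l)"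
    using pq dm
    by (simp add: tensor_map_def qc_channel_unit_mat sum_distrib_left sum_distrib_right mult_ac)
  also have "\<dots> = (\<Sum>k<m. \<Sum>l<m. \<Sum>i<d. \<Sum>j<d. \<Sum>c<d. ?f c i j k l)"
    by (rule sum_swap_pairs)
  also have "\<dots> = (\<Sum>k<m. \<Sum>l<m. \<Sum>c<d. \<Sum>i<d. \<Sum>j<d. ?f c i j k l)"
    by (intro sum.cong refl sum_rotate)
  also have "\<dots> = (\<Sum>c<d. \<Sum>k<m. \<Sum>l<m. \<Sum>i<d. \<Sum>j<d. ?f c i j k l)"
    by (rule sum_rotate)
  also have "\<dots> = (\<Sum>c<d. ?E c * (\<Sum>k<m. \<Sum>l<m. cond_op d m (M c) X $$ (k,l) * ?F k l))"
    by (simp add: cond_op_def sum_distrib_left sum_distrib_right)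
  also have "\<dots> = (\<Sum>c<d. ?E c * \<Omega> (cond_op d m (M c) X) $$ (p mod m, q mod m))"
    using linear_map_unit_mat_expansion[OF \<Omega> cond_op_carrier dm(2,4)] by simp
  also have "\<dots> = classical_quantum d m e (\<lambda>a. \<Omega> (cond_op d m (M a) X)) $$ (p,q)"
    using pq by (simp add: classical_quantum_def)
  finally show ?case .
qed (auto simp: tensor_map_def classical_quantum_def)

text \<open>Block \<open>a\<close> is \<open>q a\<close> times the state
  \<open>\<Omega> (s a)\<close>, so its entropy is \<open>q a * vn_entropy (\<Omega> (s a))\<close>
  minus q ln q at \<open>q a\<close>; the latter terms sum to the entropy of the measured marginal.
  For a single state this is an equality.\<close>

lemma vn_entropy_tensor_map_qc_channel:
  assumes \<Omega>: "channel m \<Omega>" and \<sigma>: "density (d * m) \<sigma>"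
  obtains q s where "decomposition m (ptrace1 d m \<sigma>) d q s"
    "vn_entropy (tensor_map d m (qc_channel d M e) \<Omega> \<sigma>)
      = vn_entropy (qc_channel d M e (ptrace2 d m \<sigma>)) + (\<Sum>a<d. q a * vn_entropy (\<Omega> (s a)))"
proof -
  have psd: "psd (d * m) \<sigma>" and carr: "\<sigma> \<in> carrier_mat (d * m) (d * m)" and tr: "mtrace \<sigma> = 1"
    using \<sigma> by (auto simp: density_def psd_def)
  have lin: "Defs.linear_map m \<Omega>" using \<Omega> by (simp add: channel_def)
  define T where "T a = cond_op d m (M a) \<sigma>" for a
  define q where "q a = Re (mtrace (T a))" for a
  have T_psd: "psd m (T a)" if "a < d" for a
    unfolding T_def by (rule psd_cond_op[OF M_psd[OF that] psd])
  have T_carr: "T a \<in> carrier_mat m m" for a by (simp add: T_def)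
  have q: "mtrace (T a) = complex_of_real (q a)" "0 \<le> q a" if "a < d" for a
    using mtrace_psd[OF T_psd[OF that]] by (simp_all add: q_def)
  have "(\<Sum>a<d. mtrace (T a)) = 1" using sum_mtrace_cond_op[OF carr] tr by (simp add: T_def)
  then have sum_q: "(\<Sum>a<d. q a) = 1"
    unfolding q_def by (metis Re_sum one_complex.simps(1))
  have normalised: "density m (complex_of_real (1 / q a) \<cdot>\<^sub>m T a)" if a: "a < d" "q a \<noteq> 0" for a
  proof -
    have "psd m (complex_of_real (1 / q a) \<cdot>\<^sub>m T a)"
      using psd_smult[OF T_psd[OF a(1)], of "1 / q a"] q(2)[OF a(1)] by simp
    moreover have "mtrace (complex_of_real (1 / q a) \<cdot>\<^sub>m T a) = complex_of_real (1 / q a) * mtrace (T a)"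
      using T_carr[of a] by (simp add: mtrace_def sum_distrib_left)
    ultimately show ?thesis using q(1)[OF a(1)] a(2) by (simp add: density_def)
  qed
  \<comment> \<open>Since the probabilities sum to 1, some outcome has nonzero probability; its
    conditional state is the filler used below.\<close>
  obtain a0 where a0: "a0 < d" "q a0 \<noteq> 0"
    using sum_q by (metis lessThan_iff sum.neutral zero_neq_one)
  \<comment> \<open>When \<open>q a = 0\<close> the operator \<open>T a\<close> vanishes, and any state serves as \<open>s a\<close>.\<close>
  define s where "s a = (let b = (if q a = 0 then a0 else a) in complex_of_real (1 / q b) \<cdot>\<^sub>m T b)" for a
  have s_density: "density m (s a)" if "a < d" for a
    using normalised[OF that] normalised[OF a0] by (simp add: s_def Let_def)
  have s_carr: "s a \<in> carrier_mat m m" for a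
    using T_carr by (simp add: s_def Let_def)
  have T_eq: "T a = complex_of_real (q a) \<cdot>\<^sub>m s a" if a: "a < d" for a
  proof (cases "q a = 0")
    case True
    then have "T a = 0\<^sub>m m m" using psd_zero_trace[OF T_psd[OF a]] q(1)[OF a] by simp
    then show ?thesis using True s_carr[of a] by auto
  next
    case False
    then show ?thesis using T_carr[of a] by (auto simp: s_def)
  qed
  have "decomposition m (ptrace1 d m \<sigma>) d q s"
    unfolding decomposition_def
  proof (intro conjI allI impI)
    fix k l assume kl: "k < m" "l < m"
    have "T a $$ (k,l) = complex_of_real (q a) * s a $$ (k,l)" if "a < d" for a
      using T_eq[OF that] s_carr[of a] kl by simp
    then show "ptrace1 d m \<sigma> $$ (k,l) = (\<Sum>a<d. complex_of_real (q a) * s a $$ (k,l))"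
      using sum_cond_op[OF kl, of \<sigma>] by (simp add: T_def)
  qed (use q s_density sum_q in auto)
  moreover have "vn_entropy (tensor_map d m (qc_channel d M e) \<Omega> \<sigma>)
      = vn_entropy (qc_channel d M e (ptrace2 d m \<sigma>)) + (\<Sum>a<d. q a * vn_entropy (\<Omega> (s a)))"
  proof -
    have "vn_entropy (\<Omega> (T a)) = q a * vn_entropy (\<Omega> (s a)) - xlnx (mtrace (M a * ptrace2 d m \<sigma>))"
      if a: "a < d" for a
    proof -
      have "\<Omega> (T a) = complex_of_real (q a) \<cdot>\<^sub>m \<Omega> (s a)"
        unfolding T_eq[OF a] by (rule linear_mapD(3)[OF lin s_carr])
      moreover have "mtrace (M a * ptrace2 d m \<sigma>) = complex_of_real (q a)"
        using mtrace_cond_op[OF M_carrier[OF a], of m \<sigma>] q(1)[OF a] by (simp add: T_def)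
      ultimately show ?thesis
        using vn_entropy_smult_density[OF channel_density[OF \<Omega> s_density[OF a]] q(2)[OF a]] by simp
    qed
    moreover have "vn_entropy (tensor_map d m (qc_channel d M e) \<Omega> \<sigma>) = (\<Sum>a<d. vn_entropy (\<Omega> (T a)))"
      unfolding tensor_map_qc_channel[OF lin] T_def[symmetric]
      by (rule vn_entropy_classical_quantum[OF e_orthonormal linear_mapD(1)[OF lin T_carr]])
    ultimately show ?thesis by (simp add: vn_entropy_qc_channel sum_subtractf)
  qed
  ultimately show thesis by (rule that)
qed

text \<open>The cost of a decomposition of \<open>\<rho>\<close> splits exactly into the costs of
  two induced decompositions of the marginals. The inequality enters because those need not be
  optimal.\<close>

lemma H_map_tensor_qc_channel:
  assumes \<Omega>: "channel m \<Omega>" and \<rho>: "density (d * m) \<rho>"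
  shows "H_map d (qc_channel d M e) (ptrace2 d m \<rho>) + H_map m \<Omega> (ptrace1 d m \<rho>)
    \<le> H_map (d * m) (tensor_map d m (qc_channel d M e) \<Omega>) \<rho>"
proof (rule H_map_ge[OF \<rho>])
  fix N p \<sigma> assume dec: "decomposition (d * m) \<rho> N p \<sigma>"
  let ?\<Phi> = "qc_channel d M e"
  have p: "\<forall>i<N. 0 \<le> p i" "(\<Sum>i<N. p i) = 1" and \<sigma>: "\<And>i. i < N \<Longrightarrow> density (d * m) (\<sigma> i)"
    and \<rho>_eq: "\<And>a b. a < d * m \<Longrightarrow> b < d * m \<Longrightarrow>
      \<rho> $$ (a,b) = (\<Sum>i<N. complex_of_real (p i) * \<sigma> i $$ (a,b))"
    using dec by (auto simp: decomposition_def)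
  have "\<exists>q s. decomposition m (ptrace1 d m (\<sigma> i)) d q s \<and>
      vn_entropy (tensor_map d m ?\<Phi> \<Omega> (\<sigma> i))
        = vn_entropy (?\<Phi> (ptrace2 d m (\<sigma> i))) + (\<Sum>a<d. q a * vn_entropy (\<Omega> (s a)))"
    if "i < N" for i
    using vn_entropy_tensor_map_qc_channel[OF \<Omega> \<sigma>[OF that]] by metis
  then obtain q s where qs: "\<And>i. i < N \<Longrightarrow> decomposition m (ptrace1 d m (\<sigma> i)) d (q i) (s i)"
    "\<And>i. i < N \<Longrightarrow> vn_entropy (tensor_map d m ?\<Phi> \<Omega> (\<sigma> i))
        = vn_entropy (?\<Phi> (ptrace2 d m (\<sigma> i))) + (\<Sum>a<d. q i a * vn_entropy (\<Omega> (s i a)))"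
    by metis
  have "H_map d ?\<Phi> (ptrace2 d m \<rho>) \<le> (\<Sum>i<N. p i * vn_entropy (?\<Phi> (ptrace2 d m (\<sigma> i))))"
  proof (rule H_map_le[OF _ vn_entropy_qc_channel_nonneg])
    have "ptrace2 d m \<rho> $$ (a,b) = (\<Sum>i<N. complex_of_real (p i) * ptrace2 d m (\<sigma> i) $$ (a,b))"
      if "a < d" "b < d" for a b
    proof -
      have "ptrace2 d m \<rho> $$ (a,b) = (\<Sum>k<m. \<Sum>i<N. complex_of_real (p i) * \<sigma> i $$ (a * m + k, b * m + k))"
        using that by (simp add: ptrace2_def \<rho>_eq mult_add_less_mult)
      then show ?thesis
        using that by (subst (asm) sum.swap) (simp add: ptrace2_def sum_distrib_left)
    qed
    then show "decomposition d (ptrace2 d m \<rho>) N p (\<lambda>i. ptrace2 d m (\<sigma> i))"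
      using p density_ptrace2[OF \<sigma>] by (simp add: decomposition_def)
  qed
  moreover have "H_map m \<Omega> (ptrace1 d m \<rho>) \<le> (\<Sum>i<N. p i * (\<Sum>a<d. q i a * vn_entropy (\<Omega> (s i a))))"
  proof -
    have "ptrace1 d m \<rho> $$ (k,l) = (\<Sum>i<N. complex_of_real (p i) * ptrace1 d m (\<sigma> i) $$ (k,l))"
      if "k < m" "l < m" for k l
    proof -
      have "ptrace1 d m \<rho> $$ (k,l) = (\<Sum>j<d. \<Sum>i<N. complex_of_real (p i) * \<sigma> i $$ (j * m + k, j * m + l))"
        using that by (simp add: ptrace1_def \<rho>_eq mult_add_less_mult)
      then show ?thesis
        using that by (subst (asm) sum.swap) (simp add: ptrace1_def sum_distrib_left)
    qed
    \<comment> \<open>The \<open>N * d\<close> states \<open>s i a\<close> with weights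
      \<open>p i * q i a\<close> decompose the second marginal, since for each \<open>i\<close> the
      \<open>s i a\<close> average to the marginal of \<open>\<sigma> i\<close>.\<close>
    from H_map_le[where F = \<Omega>, OF decomposition_refine[OF p this qs(1)]]
    have "H_map m \<Omega> (ptrace1 d m \<rho>) \<le> (\<Sum>r<N * d. p (r div d) * q (r div d) (r mod d)
        * vn_entropy (\<Omega> (s (r div d) (r mod d))))"
      using vn_entropy_density_nonneg[OF channel_density[OF \<Omega>]] by blast
    also have "\<dots> = (\<Sum>i<N. p i * (\<Sum>a<d. q i a * vn_entropy (\<Omega> (s i a))))"
      unfolding sum_lessThan_mult sum_distrib_left by (intro sum.cong refl) simp
    finally show ?thesis .
  qed
  ultimately show "H_map d ?\<Phi> (ptrace2 d m \<rho>) + H_map m \<Omega> (ptrace1 d m \<rho>)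
      \<le> (\<Sum>i<N. p i * vn_entropy (tensor_map d m ?\<Phi> \<Omega> (\<sigma> i)))"
    by (simp add: qs(2) sum.distrib distrib_left)
qed

end

section \<open>From positive definite measurement operators to the theorem\<close>

lemma pd_imp_psd:
  assumes "pd n A"
  shows "psd n A"
proof -
  have "0 \<le> Re (qform A v)" if "v \<in> carrier_vec n" for v
  proof (cases "v = 0\<^sub>v n")
    case True
    then show ?thesis by (simp add: qform_def)
  next
    case False
    then show ?thesis using assms that by (auto simp: pd_def less_imp_le)
  qed
  then show ?thesis using assms by (simp add: pd_def psd_def)
qed

theorem theorem5:
  fixes d m :: nat and M :: "nat \<Rightarrow> complex mat" and e :: "nat \<Rightarrow> complex vec"
    and \<Omega> :: "complex mat \<Rightarrow> complex mat" and \<rho> :: "complex mat"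
  assumes M_pd: "\<forall>j<d. pd d (M j)"
    and M_sum: "\<forall>a<d. \<forall>b<d. (\<Sum>j<d. M j $$ (a,b)) = (1\<^sub>m d) $$ (a,b)"
    and e_carrier: "\<forall>j<d. e j \<in> carrier_vec d"
    and e_orthonormal: "\<forall>i<d. \<forall>j<d. cinner (e i) (e j) = (if i = j then 1 else 0)"
    and \<Omega>_channel: "channel m \<Omega>"
    and \<rho>_state: "density (d*m) \<rho>"
  shows "H_map (d*m) (tensor_map d m (qc_channel d M e) \<Omega>) \<rho>
     \<ge> H_map d (qc_channel d M e) (ptrace2 d m \<rho>) + H_map m \<Omega> (ptrace1 d m \<rho>)"
proof -
  interpret qc_measurement d M e
    using assms by unfold_locales (auto simp: pd_imp_psd orthonormal_def)
  show ?thesis using \<Omega>_channel \<rho>_state by (rule H_map_tensor_qc_channel)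
qed

end
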